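(* Let $d\ge3$ and let $f$ be the Gaussian free field on $\mathbb{Z}^d$. For every $\ell\in\mathbb{R}$ there exists $c>0$ such that, for every $R\ge1$, $$\mathrm{Var}[N_R(\ell)]\ge cR^d.$$
   Context: The Gaussian free field (GFF) on $\mathbb{Z}^d$, $d\ge 3$, is the centred stationary Gaussian field $f=(f(x))_{x\in\mathbb{Z}^d}$ with $\mathbb{E}[f(x)f(y)]=G(x-y)$, where $G(x)=\sum_{k\ge0}\mathbb{P}[X_k=x\mid X_0=0]$ is the Green's function of the simple random walk on $\mathbb{Z}^d$. $\mathbb{Z}^d$ carries its nearest-neighbour graph structure ($x\sim y$ denotes adjacency). $\{f>\ell\}=\{x\in\mathbb{Z}^d:f(x)>\ell\}$ and $\{f<\ell\}$ is defined similarly. $\Lambda_R=[-R,R]^d\cap\mathbb{Z}^d$ and $\partial D=\{x\in D:\exists y\notin D,\ x\sim y\}$. $N_R^+(\ell)$ (resp. $N_R^-(\ell)$) is the number of connected components of $\{f>\ell\}$ (resp. $\{f<\ell\}$) that intersect $\Lambda_R$ but not $\partial\Lambda_R$, and $N_R(\ell)=N_R^+(\ell)+N_R^-(\ell)$. *)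

theory Defs
  imports "HOL-Probability.Probability"
begin

section \<open>The nearest-neighbour lattice\<close>

text \<open>The lattice of dimension \<open>d = CARD('d)\<close> is the type \<open>int ^ 'd\<close>.\<close>

definition lattice_adj :: "int ^ 'd \<Rightarrow> int ^ 'd \<Rightarrow> bool" where
  "lattice_adj x y \<longleftrightarrow> (\<Sum>i\<in>UNIV. \<bar>x $ i - y $ i\<bar>) = 1"

definition lattice_box :: "real \<Rightarrow> (int ^ 'd) set" where
  "lattice_box R = {x. \<forall>i. - R \<le> real_of_int (x $ i) \<and> real_of_int (x $ i) \<le> R}"

definition lattice_boundary :: "(int ^ 'd) set \<Rightarrow> (int ^ 'd) set" where
  "lattice_boundary D = {x \<in> D. \<exists>y. y \<notin> D \<and> lattice_adj x y}"

definition joined_in :: "(int ^ 'd) set \<Rightarrow> (int ^ 'd) rel" where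
  "joined_in S =
     {(x, y) \<in> S \<times> S. (x, y) \<in> {(u, v). u \<in> S \<and> v \<in> S \<and> lattice_adj u v}\<^sup>*}"

definition lattice_components :: "(int ^ 'd) set \<Rightarrow> (int ^ 'd) set set" where
  "lattice_components S = S // joined_in S"

section \<open>Simple random walk and its Green's function\<close>

text \<open>\<open>srw x k\<close> is the law of the position after \<open>k\<close> steps of the walk started at \<open>x\<close>.\<close>

primrec srw :: "int ^ 'd \<Rightarrow> nat \<Rightarrow> (int ^ 'd) pmf" where
  "srw x 0 = return_pmf x"
| "srw x (Suc k) = bind_pmf (srw x k) (\<lambda>y. pmf_of_set {z. lattice_adj y z})"

text \<open>The walk is transient for \<open>CARD('d) \<ge> 3\<close>, so the series below converges in that case;
  in lower dimension it diverges at \<open>0\<close> and the definition is not meaningful.\<close>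

definition green :: "int ^ 'd \<Rightarrow> real" where
  "green x = (\<Sum>k. pmf (srw 0 k) x)"

section \<open>Gaussian fields\<close>

text \<open>Point masses are included as Gaussian laws of variance zero, because a finite linear
  combination of jointly Gaussian variables may be degenerate.\<close>

definition gaussian_rv :: "'w measure \<Rightarrow> ('w \<Rightarrow> real) \<Rightarrow> bool" where
  "gaussian_rv M X \<longleftrightarrow> X \<in> borel_measurable M \<and>
     ((\<exists>\<mu> \<sigma>. 0 < \<sigma> \<and> distributed M lborel X (normal_density \<mu> \<sigma>)) \<or>
      (\<exists>\<mu>. AE \<omega> in M. X \<omega> = \<mu>))"

definition gaussian_field :: "'w measure \<Rightarrow> ('i \<Rightarrow> 'w \<Rightarrow> real) \<Rightarrow> bool" where
  "gaussian_field M f \<longleftrightarrow>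
     (\<forall>S a. finite S \<longrightarrow> gaussian_rv M (\<lambda>\<omega>. \<Sum>x\<in>S. a x * f x \<omega>))"

text \<open>Stationarity is not listed: a centred Gaussian field has its law determined by its
  covariance, which here depends on \<open>x - y\<close> only.\<close>

definition gaussian_free_field :: "'w measure \<Rightarrow> (int ^ 'd \<Rightarrow> 'w \<Rightarrow> real) \<Rightarrow> bool" where
  "gaussian_free_field M f \<longleftrightarrow> prob_space M \<and> gaussian_field M f \<and>
     (\<forall>x. prob_space.expectation M (f x) = 0) \<and>
     (\<forall>x y. prob_space.expectation M (\<lambda>\<omega>. f x \<omega> * f y \<omega>) = green (x - y))"

section \<open>Counting excursion components\<close>

text \<open>The component counts are functions of a single realisation \<open>h\<close> of the field. The
  components counted are disjoint and all meet the finite box, so \<open>card\<close> is applied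
  to a finite set.\<close>

definition inner_components :: "real \<Rightarrow> (int ^ 'd) set \<Rightarrow> (int ^ 'd) set set" where
  "inner_components R S = {C \<in> lattice_components S.
     C \<inter> lattice_box R \<noteq> {} \<and> C \<inter> lattice_boundary (lattice_box R) = {}}"

definition N_plus :: "real \<Rightarrow> real \<Rightarrow> (int ^ 'd \<Rightarrow> real) \<Rightarrow> nat" where
  "N_plus R l h = card (inner_components R {x. h x > l})"

definition N_minus :: "real \<Rightarrow> real \<Rightarrow> (int ^ 'd \<Rightarrow> real) \<Rightarrow> nat" where
  "N_minus R l h = card (inner_components R {x. h x < l})"

definition N_total :: "real \<Rightarrow> real \<Rightarrow> (int ^ 'd \<Rightarrow> real) \<Rightarrow> nat" where
  "N_total R l h = N_plus R l h + N_minus R l h"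

end

(* Write d for the dimension. By the Green's function equation, xi x = f x - (average of f over the
   neighbours of x) is standard normal and orthogonal to f y for all y \<noteq> x, hence independent of
   the family of these f y. Let x range over the points of the even sublattice in the interior of the
   box, and let E x be the event that f < l on the 3^d block around x with x removed and that the
   neighbour average at x is at least l - K. On E x the block with x removed is connected inside
   {f < l}, so the only effect of moving f x across l is to create or destroy the component {x}.
   For a bounded function g with E (g (xi x)) = 0, positive on large and negative on very negative
   arguments, the variables Y x = 1_{E x} g (xi x) are therefore orthogonal and each has covariance
   with N_R bounded below, provided P (E x) is bounded below uniformly in x; Bessel's inequality
   then gives the variance bound. The bound on P (E x) follows by resampling one site at a time. *)

theory Submission
  imports Defs
begin

section \<open>Transience and the Green's function\<close>

text \<open>The field has slowly decaying correlations, so there is no family of nearly independent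
  blocks to sum over. What replaces it is independence of one innovation from the whole remaining
  field: the events E x may be correlated in any way, yet conditioning on everything except one site
  kills the mixed moments of the Y x, and a second-moment bound asks for no more. This requires that
  Y y be determined by the field off x for any two chosen sites, which is why the sites are even:
  then no block contains another site. The 3^d block is used instead of the nearest neighbours
  because the latter are pairwise non-adjacent. If only they were known to lie below the level, x
  could link several components of the lower set, and the change of the count would depend on the
  field far away. The diagonal points of the block link the neighbours locally, so the change is
  exactly one.\<close>

definition nbrs :: "int ^ 'd \<Rightarrow> (int ^ 'd) set" where
  "nbrs x = {z. lattice_adj x z}"

lemma lattice_adj_commute: "lattice_adj x y \<longleftrightarrow> lattice_adj y x"
  unfolding lattice_adj_def by (simp add: abs_minus_commute)

text \<open>The summands are nonnegative integers, so one nonzero summand already uses up the whole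
  sum.\<close>

lemma lattice_adj_iff_axis:
  "lattice_adj x y \<longleftrightarrow> (\<exists>i. y = x + axis i 1 \<or> y = x + axis i (-1))"
proof
  assume a: "lattice_adj x y"
  then have s: "(\<Sum>i\<in>UNIV. \<bar>x $ i - y $ i\<bar>) = 1" by (simp add: lattice_adj_def)
  then obtain i where i: "\<bar>x $ i - y $ i\<bar> \<noteq> 0"
    by (metis (mono_tags, lifting) sum.neutral zero_neq_one)
  have "(\<Sum>i\<in>UNIV. \<bar>x $ i - y $ i\<bar>) = \<bar>x $ i - y $ i\<bar> + (\<Sum>j\<in>UNIV - {i}. \<bar>x $ j - y $ j\<bar>)"
    by (simp add: sum.remove)
  moreover have "0 \<le> (\<Sum>j\<in>UNIV - {i}. \<bar>x $ j - y $ j\<bar>)" by (rule sum_nonneg) simp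
  ultimately have 1: "\<bar>x $ i - y $ i\<bar> = 1" and 0: "(\<Sum>j\<in>UNIV - {i}. \<bar>x $ j - y $ j\<bar>) = 0"
    using s i by linarith+
  from 0 have "\<forall>j\<in>UNIV - {i}. \<bar>x $ j - y $ j\<bar> = 0"
    by (subst (asm) sum_nonneg_eq_0_iff) auto
  then have "y = x + axis i (y $ i - x $ i)"
    by (auto simp: vec_eq_iff axis_def)
  moreover have "y $ i - x $ i = 1 \<or> y $ i - x $ i = -1" using 1 by linarith
  ultimately show "\<exists>i. y = x + axis i 1 \<or> y = x + axis i (-1)" by metis
next
  assume "\<exists>i. y = x + axis i 1 \<or> y = x + axis i (-1)"
  then obtain i c where y: "y = x + axis i c" and c: "c = 1 \<or> c = -1" by blast
  have "(\<Sum>j\<in>UNIV. \<bar>x $ j - y $ j\<bar>) = (\<Sum>j\<in>UNIV. if j = i then \<bar>c\<bar> else 0)"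
    by (rule sum.cong) (auto simp: y axis_def)
  then show "lattice_adj x y" using c by (auto simp: lattice_adj_def)
qed

lemma nbrs_eq_image: "nbrs x = (\<lambda>(i, s). x + axis i s) ` (UNIV \<times> {1, -1})"
  unfolding nbrs_def lattice_adj_iff_axis by force

lemma inj_axis_step: "inj_on (\<lambda>(i, s). x + axis i s) (UNIV \<times> {1, - 1 :: int})"
  by (auto simp: inj_on_def axis_eq_axis)

lemma finite_nbrs [simp]: "finite (nbrs x)"
  by (simp add: nbrs_eq_image)

lemma sum_nbrs:
  fixes x :: "int ^ 'd"
  shows "(\<Sum>z\<in>nbrs x. \<phi> z) = (\<Sum>i\<in>UNIV. \<phi> (x + axis i 1) + \<phi> (x + axis i (-1)))"
  unfolding nbrs_eq_image
  by (subst sum.reindex[OF inj_axis_step])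
     (simp add: sum.cartesian_product' comp_def)

lemma card_nbrs: "card (nbrs (x :: int ^ 'd)) = 2 * CARD('d)"
  using sum_nbrs[of "\<lambda>_. 1 :: nat" x] by simp

lemma nbrs_nonempty [simp]: "nbrs (x :: int ^ 'd) \<noteq> {}"
  using card_nbrs[of x] by (metis card.empty mult_eq_0_iff zero_less_card_finite zero_neq_numeral neq0_conv)

lemma mem_nbrs_commute: "x \<in> nbrs y \<longleftrightarrow> y \<in> nbrs x"
  by (simp add: nbrs_def lattice_adj_commute)

lemma not_mem_nbrs_self [simp]: "x \<notin> nbrs x"
  by (simp add: nbrs_def lattice_adj_def)

lemma nbrs_diff: "nbrs (x - y) = (\<lambda>z. z - y) ` nbrs x"
  by (force simp: nbrs_eq_image)

lemma srw_Suc: "srw x (Suc k) = bind_pmf (srw x k) (\<lambda>y. pmf_of_set (nbrs y))"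
  by (simp add: nbrs_def)

text \<open>Adjacency is symmetric and all degrees agree, so the last step into \<open>y\<close> has
  the same weight as a step out of \<open>y\<close>.\<close>

lemma pmf_srw_Suc:
  fixes x y :: "int ^ 'd"
  shows "pmf (srw x (Suc k)) y = (\<Sum>z\<in>nbrs y. pmf (srw x k) z) / (2 * CARD('d))"
proof -
  have "pmf (srw x (Suc k)) y = measure_pmf.expectation (srw x k) (\<lambda>z. indicator (nbrs z) y / (2 * CARD('d)))"
    unfolding srw_Suc pmf_bind by (simp add: card_nbrs)
  also have "\<dots> = measure_pmf.expectation (srw x k) (\<lambda>z. indicator (nbrs y) z / (2 * CARD('d)))"
    by (intro arg_cong[where f = "measure_pmf.expectation _"] ext)
       (simp add: indicator_def mem_nbrs_commute)
  also have "\<dots> = (\<Sum>z\<in>nbrs y. pmf (srw x k) z) / (2 * CARD('d))"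
    by (simp add: measure_measure_pmf_finite)
  finally show ?thesis .
qed

section \<open>A Lyapunov function for the random walk\<close>

lemma powr_neg_quarter_le:
  fixes z :: real
  assumes "z \<ge> -0.18"
  shows "(1 + z) powr (-1/4) \<le> 1 - z / 4 + 3 / 16 * z\<^sup>2"
proof -
  \<comment> \<open>In terms of the fourth root the claim is polynomial. Cleared of fractions, the
    difference of the two sides has a double root at \<open>y = 1\<close>, since both sides agree to
    first order at \<open>z = 0\<close>.\<close>
  define y where "y = (1 + z) powr (1/4)"
  have y4: "y ^ 4 = 1 + z" using assms unfolding y_def by (subst powr_power) auto
  have ypos: "y > 0" using assms by (simp add: y_def)
  have y: "y \<ge> 0.95"
  proof (rule ccontr)
    assume "\<not> y \<ge> 0.95"
    then have "y ^ 4 \<le> 0.95 ^ 4" using ypos by (intro power_mono) auto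
    then show False using assms y4 by (simp add: power4_eq_xxxx)
  qed
  \<comment> \<open>The negative terms in \<open>y^2\<close> and \<open>y\<close> are absorbed by
    \<open>y^3\<close> and \<open>y^4\<close>; what is left is increasing and still positive at
    0.95.\<close>
  have q: "3*y^7+6*y^6+9*y^5+12*y^4+5*y^3-2*y^2-9*y-16 \<ge> 0"
  proof -
    have "y^2 \<ge> 0.95^2" "y^3 \<ge> 0.95^3" "y^4 \<ge> 0.95^4" "y^5 \<ge> 0.95^5" "y^6 \<ge> 0.95^6" "y^7 \<ge> 0.95^7"
      using y by (intro power_mono; simp)+
    moreover have "y^3 \<ge> 0.95 * y^2" using y
      by (simp add: power2_eq_square power3_eq_cube mult_right_mono)
    moreover have "y^4 \<ge> 0.95^3 * y"
      using mult_right_mono[OF \<open>y^3 \<ge> 0.95^3\<close>, of y] ypos by (simp add: power4_eq_xxxx power3_eq_cube)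
    ultimately show ?thesis by (simp add: power_numeral_reduce)
  qed
  have "16 * (y * (1 - z / 4 + 3 / 16 * z\<^sup>2) - 1)
      = (y - 1)\<^sup>2 * (3*y^7+6*y^6+9*y^5+12*y^4+5*y^3-2*y^2-9*y-16)"
  proof -
    have z: "z = y ^ 4 - 1" using y4 by simp
    show ?thesis unfolding z by algebra
  qed
  also have "\<dots> \<ge> 0" using q by simp
  finally have "1 \<le> y * (1 - z / 4 + 3 / 16 * z\<^sup>2)" by simp
  then have "1 / y \<le> 1 - z / 4 + 3 / 16 * z\<^sup>2"
    using ypos by (simp add: pos_divide_le_eq mult.commute)
  moreover have "(1 + z) powr (-1/4) = 1 / y"
    unfolding y_def by (simp add: powr_minus_divide)
  ultimately show ?thesis by simp
qed

lemma powr_neg_quarter_ge: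
  fixes e :: real
  assumes "0 \<le> e" "e < 1"
  shows "1 + e / 4 \<le> (1 - e) powr (-1/4)"
proof -
  have "ln (1 - e) \<le> - e" using ln_le_minus_one[of "1 - e"] assms by simp
  then have "1 + e / 4 \<le> 1 + (- 1 / 4 * ln (1 - e))" by simp
  also have "\<dots> \<le> exp (- 1 / 4 * ln (1 - e))" by (rule exp_ge_add_one_self)
  also have "\<dots> = (1 - e) powr (-1/4)" using assms by (simp add: powr_def)
  finally show ?thesis .
qed

definition sqnorm :: "int ^ 'd \<Rightarrow> real" where
  "sqnorm x = (\<Sum>i\<in>UNIV. (real_of_int (x $ i))\<^sup>2)"

definition lyap :: "int ^ 'd \<Rightarrow> real" where
  "lyap x = (200 + sqnorm x) powr (-1/4)"

lemma sqnorm_nonneg: "0 \<le> sqnorm x"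
  by (simp add: sqnorm_def sum_nonneg)

lemma lyap_nonneg: "0 \<le> lyap x" and lyap_le_1: "lyap x \<le> 1"
  using sqnorm_nonneg[of x] powr_mono2'[of "-1/4" 1 "200 + sqnorm x"] by (auto simp: lyap_def)

lemma sqnorm_step: "sqnorm (x + axis i c) = sqnorm x + 2 * c * x $ i + c\<^sup>2"
proof -
  have "sqnorm (x + axis i c)
      = (\<Sum>j\<in>UNIV. (real_of_int (x $ j))\<^sup>2 + (if j = i then 2 * real_of_int c * real_of_int (x $ i) + (real_of_int c)\<^sup>2 else 0))"
    unfolding sqnorm_def by (rule sum.cong) (auto simp: axis_def power2_eq_square algebra_simps)
  then show ?thesis by (simp add: sum.distrib sqnorm_def)
qed

text \<open>In the continuum \<open>r powr (- 1/2)\<close> is superharmonic in dimension at least 3; the offset 200 makes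
  the fourth-order discretisation error harmless near the origin.\<close>

lemma lyap_superharmonic:
  fixes x :: "int ^ 'd"
  assumes "CARD('d) \<ge> 3"
  shows "(\<Sum>z\<in>nbrs x. lyap z) / (2 * CARD('d)) \<le> lyap x"
proof -
  \<comment> \<open>Both neighbours in direction \<open>i\<close> have \<open>200 + sqnorm\<close>
    equal to \<open>v\<close> plus or minus \<open>2 * x $ i\<close>: the 201 absorbs the square of
    the unit step.\<close>
  define v where "v = 201 + sqnorm x"
  have v: "v \<ge> 201" using sqnorm_nonneg[of x] by (simp add: v_def)
  define A where "A = v powr (-1/4)"
  have A: "A > 0" using v by (simp add: A_def)
  have step: "lyap (x + axis i c) \<le> A * (1 - z / 4 + 3 / 16 * z\<^sup>2)"
    if c: "c = 1 \<or> c = -1" and z: "z = 2 * c * x $ i / v" for i c z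
  proof -
    have "(real_of_int (x $ i))\<^sup>2 \<le> sqnorm x" unfolding sqnorm_def
      by (rule member_le_sum) auto
    also have "\<dots> \<le> v" by (simp add: v_def)
    finally have "4 * (real_of_int (x $ i))\<^sup>2 \<le> 4 * v" by simp
    moreover have "z\<^sup>2 = 4 * (real_of_int (x $ i))\<^sup>2 / v\<^sup>2" using c by (auto simp: z power2_eq_square)
    ultimately have "z\<^sup>2 \<le> 4 * v / v\<^sup>2" by (simp add: divide_right_mono)
    also have "\<dots> = 4 / v" using v by (simp add: power2_eq_square)
    also have "\<dots> \<le> 0.18\<^sup>2" using v by (simp add: field_simps power2_eq_square)
    finally have "\<bar>z\<bar> \<le> 0.18" by (simp add: abs_le_square_iff[symmetric])
    then have z': "z \<ge> -0.18" by linarith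
    have "200 + sqnorm (x + axis i c) = v * (1 + z)"
      using c v unfolding sqnorm_step z by (auto simp: v_def field_simps)
    then have "lyap (x + axis i c) = A * (1 + z) powr (-1/4)"
      unfolding lyap_def A_def using v z' by (simp add: powr_mult)
    also have "\<dots> \<le> A * (1 - z / 4 + 3 / 16 * z\<^sup>2)"
      using powr_neg_quarter_le[OF z'] A by simp
    finally show ?thesis .
  qed
  \<comment> \<open>The first-order terms of opposite neighbours cancel.\<close>
  have pair: "lyap (x + axis i 1) + lyap (x + axis i (-1)) \<le> A * (2 + 3 / 2 * (real_of_int (x $ i))\<^sup>2 / v\<^sup>2)" for i
  proof -
    have "lyap (x + axis i 1) + lyap (x + axis i (-1)) \<le>
      A * (1 - (2 * x $ i / v) / 4 + 3 / 16 * (2 * x $ i / v)\<^sup>2) +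
      A * (1 - (- 2 * x $ i / v) / 4 + 3 / 16 * (- 2 * x $ i / v)\<^sup>2)"
      by (intro add_mono step) auto
    also have "\<dots> = A * (2 + 3 / 2 * (real_of_int (x $ i))\<^sup>2 / v\<^sup>2)"
      using v by (simp add: field_simps power2_eq_square)
    finally show ?thesis .
  qed
  have "(\<Sum>z\<in>nbrs x. lyap z) \<le> (\<Sum>i\<in>UNIV. A * (2 + 3 / 2 * (real_of_int (x $ i))\<^sup>2 / v\<^sup>2))"
    unfolding sum_nbrs by (intro sum_mono pair)
  also have "\<dots> = A * (2 * CARD('d) + 3 / 2 * sqnorm x / v\<^sup>2)"
    by (simp add: sqnorm_def sum_distrib_left sum.distrib sum_divide_distrib algebra_simps)
  \<comment> \<open>The dimension enters here. With a coefficient c in place of 3/16 this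
    computation would need c \<le> d/16, so 3/16 is the most that d = 3 allows.\<close>
  also have "\<dots> \<le> A * (2 * CARD('d) + CARD('d) / (2 * v))"
  proof -
    have "3 / 2 * sqnorm x / v\<^sup>2 \<le> 3 / 2 * v / v\<^sup>2" by (intro divide_right_mono) (auto simp: v_def)
    also have "\<dots> = 3 / (2 * v)" using v by (simp add: power2_eq_square)
    also have "\<dots> \<le> CARD('d) / (2 * v)" using v assms by (intro divide_right_mono) auto
    finally show ?thesis using A by simp
  qed
  finally have "(\<Sum>z\<in>nbrs x. lyap z) / (2 * CARD('d)) \<le> A * (2 * CARD('d) + CARD('d) / (2 * v)) / (2 * CARD('d))"
    by (intro divide_right_mono) auto
  also have "\<dots> = A * (1 + (1 / v) / 4)" using v by (simp add: field_simps)
  \<comment> \<open>The value at \<open>x\<close> itself belongs to \<open>v - 1\<close>, and this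
    deficit of one pays exactly for the second-order term.\<close>
  also have "\<dots> \<le> A * (1 - 1 / v) powr (-1/4)"
    using A v by (intro mult_left_mono powr_neg_quarter_ge) auto
  also have "\<dots> = (v * (1 - 1 / v)) powr (-1/4)"
    using v unfolding A_def by (subst powr_mult) auto
  also have "v * (1 - 1 / v) = 200 + sqnorm x" using v by (simp add: v_def field_simps)
  finally show ?thesis by (simp add: lyap_def)
qed

text \<open>The gap that each visit of the walk is charged for. All neighbours of the origin have
  \<open>sqnorm\<close> one, so it is the gap between 200 and 201.\<close>

lemma lyap_strict_at_0: "(\<Sum>z\<in>nbrs (0 :: int ^ 'd). lyap z) / (2 * CARD('d)) < lyap (0 :: int ^ 'd)"
proof -
  have "lyap (0 + axis i c :: int ^ 'd) = 201 powr (-1/4)" if "c = 1 \<or> c = -1" for i c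
    using that unfolding lyap_def sqnorm_step by (auto simp: sqnorm_def)
  then have "(\<Sum>z\<in>nbrs (0 :: int ^ 'd). lyap z) / (2 * CARD('d)) = 201 powr (-1/4)"
    unfolding sum_nbrs by simp
  also have "\<dots> < 200 powr (-1/4)" by (rule powr_less_mono2_neg) auto
  finally show ?thesis by (simp add: lyap_def sqnorm_def)
qed

text \<open>Transience: \<open>E (lyap (X\<^sub>k - y))\<close> is nonnegative and drops by at least a fixed multiple
  of \<open>P (X\<^sub>k = y)\<close> in every step.\<close>

lemma summable_srw:
  fixes x y :: "int ^ 'd"
  assumes "CARD('d) \<ge> 3"
  shows "summable (\<lambda>k. pmf (srw x k) y)"
proof -
  define P where "P \<phi> z = (\<Sum>w\<in>nbrs z. \<phi> w) / (2 * CARD('d))" for \<phi> :: "int ^ 'd \<Rightarrow> real" and z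
  define h where "h z = lyap (z - y)" for z
  define \<delta> where "\<delta> = lyap (0 :: int ^ 'd) - P lyap 0"
  have \<delta>: "\<delta> > 0" using lyap_strict_at_0 by (simp add: \<delta>_def P_def)
  have Ph: "P h z = P lyap (z - y)" for z
    unfolding P_def h_def nbrs_diff by (subst sum.reindex) (auto simp: inj_on_def)
  \<comment> \<open>The strict gap is translated from the origin to \<open>y\<close>; elsewhere
    plain superharmonicity is used.\<close>
  have drop: "P h z \<le> h z - \<delta> * indicator {y} z" for z
    using lyap_superharmonic[OF assms, of "z - y"]
    unfolding Ph by (cases "z = y") (auto simp: \<delta>_def P_def h_def)
  have hb: "0 \<le> h z" "h z \<le> 1" for z by (simp_all add: h_def lyap_nonneg lyap_le_1)
  have int: "integrable (measure_pmf (srw x k)) h" for k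
    using hb by (intro measure_pmf.integrable_const_bound[where B = 1]) auto
  define a where "a k = measure_pmf.expectation (srw x k) h" for k
  have a0: "a k \<ge> 0" for k unfolding a_def using hb by (intro integral_nonneg_AE) auto
  have aS: "a (Suc k) \<le> a k - \<delta> * pmf (srw x k) y" for k
  proof -
    have Ph0: "0 \<le> P h z" for z
      unfolding P_def using hb by (intro divide_nonneg_nonneg sum_nonneg) auto
    have intP: "integrable (measure_pmf (srw x k)) (P h)"
    proof (intro measure_pmf.integrable_const_bound[where B = 1] AE_I2)
      fix z
      have "P h z \<le> 1" using drop[of z] hb[of z] \<delta>
        by (cases "z = y") auto
      then show "norm (P h z) \<le> 1" using Ph0[of z] by simp
    qed simp
    \<comment> \<open>The one-step average is computed with nonnegative integrals, where
      \<open>bind_pmf\<close> unfolds without an integrability condition.\<close>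
    have "ennreal (a (Suc k)) = (\<integral>\<^sup>+ z. h z \<partial>srw x (Suc k))"
      unfolding a_def using int[of "Suc k"] hb
      by (intro nn_integral_eq_integral[symmetric]) (auto simp del: srw.simps)
    also have "\<dots> = (\<integral>\<^sup>+ z. (\<integral>\<^sup>+ w. h w \<partial>pmf_of_set (nbrs z)) \<partial>srw x k)"
      unfolding srw_Suc by simp
    also have "\<dots> = (\<integral>\<^sup>+ z. ennreal (P h z) \<partial>srw x k)"
      by (intro nn_integral_cong)
         (simp add: nn_integral_pmf_of_set P_def card_nbrs sum_ennreal hb sum_nonneg
            ennreal_of_nat_eq_real_of_nat divide_ennreal)
    also have "\<dots> = ennreal (measure_pmf.expectation (srw x k) (P h))"
      using intP Ph0 by (intro nn_integral_eq_integral) auto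
    finally have "a (Suc k) = measure_pmf.expectation (srw x k) (P h)"
      using Ph0 a0 by (subst (asm) ennreal_inj) (auto intro!: integral_nonneg_AE)
    also have "\<dots> \<le> measure_pmf.expectation (srw x k) (\<lambda>z. h z - \<delta> * indicator {y} z)"
      using int[of k] intP
      by (intro integral_mono drop Bochner_Integration.integrable_diff integrable_mult_right)
         (auto simp: less_top[symmetric])
    also have "\<dots> = a k - \<delta> * pmf (srw x k) y"
      unfolding a_def using int[of k]
      by (subst Bochner_Integration.integral_diff) (auto simp: measure_pmf_single less_top[symmetric])
    finally show ?thesis .
  qed
  have "\<delta> * (\<Sum>k<n. pmf (srw x k) y) \<le> a 0 - a n" for n
  proof (induction n)
    case (Suc n)
    then show ?case using aS[of n] by (simp add: algebra_simps)
  qed simp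
  then have "(\<Sum>k<n. pmf (srw x k) y) \<le> a 0 / \<delta>" for n
    using a0[of n] \<delta> by (simp add: pos_le_divide_eq mult.commute) (smt (verit))
  then show ?thesis by (intro summableI_nonneg_bounded[where x = "a 0 / \<delta>"]) auto
qed

text \<open>The time-zero term of the series is the point mass on the right. Transience permits
  shifting the series and exchanging it with the neighbour average.\<close>

lemma green_equation:
  fixes x :: "int ^ 'd"
  assumes "CARD('d) \<ge> 3"
  shows "green x - (\<Sum>z\<in>nbrs x. green z) / (2 * CARD('d)) = (if x = 0 then 1 else 0)"
proof -
  note S = summable_srw[OF assms]
  have "green x = pmf (srw 0 0) x + (\<Sum>k. pmf (srw 0 (Suc k)) x)"
    unfolding green_def using suminf_split_head[OF S[of 0 x]] by simp
  also have "(\<Sum>k. pmf (srw 0 (Suc k)) x) = (\<Sum>k. (\<Sum>z\<in>nbrs x. pmf (srw 0 k) z)) / (2 * CARD('d))"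
    unfolding pmf_srw_Suc by (intro suminf_divide summable_sum S)
  also have "(\<Sum>k. (\<Sum>z\<in>nbrs x. pmf (srw 0 k) z)) = (\<Sum>z\<in>nbrs x. green z)"
    unfolding green_def by (intro suminf_sum S)
  finally show ?thesis by simp
qed

section \<open>Independence in Gaussian fields\<close>

text \<open>Levy's uniqueness theorem for the law of \<open>Y\<close> under \<open>M\<close> and under the density \<open>1 + Z\<close>.\<close>

lemma (in prob_space) real_integral_indicator_eq_0:
  fixes Z :: "'a \<Rightarrow> real"
  assumes [measurable]: "Y \<in> borel_measurable M" "Z \<in> borel_measurable M" "B \<in> sets borel"
    and bound: "\<And>w. \<bar>Z w\<bar> \<le> 1"
    and zero: "\<And>t. (CLINT w|M. complex_of_real (Z w) * iexp (t * Y w)) = 0"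
  shows "expectation (\<lambda>w. Z w * indicator B (Y w)) = 0"
proof -
  have intZ: "integrable M Z" using bound by (intro integrable_const_bound[where B = 1]) auto
  have pos: "0 \<le> 1 + Z w" for w using bound[of w] by linarith
  \<comment> \<open>The case t = 0 of the hypothesis; it makes \<open>1 + Z\<close> a probability
    density.\<close>
  have EZ: "expectation Z = 0"
    using zero[of 0] by (simp add: integral_complex_of_real)
  define D where "D = density M (\<lambda>w. ennreal (1 + Z w))"
  have [measurable]: "Y \<in> borel_measurable D" by (simp add: D_def)
  have "emeasure D (space D) = (\<integral>\<^sup>+ w. ennreal (1 + Z w) \<partial>M)"
    unfolding D_def by (subst emeasure_density) (auto intro!: nn_integral_cong)
  also have "\<dots> = ennreal (expectation (\<lambda>w. 1 + Z w))"
    using intZ pos by (intro nn_integral_eq_integral) auto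
  also have "expectation (\<lambda>w. 1 + Z w) = 1" using intZ EZ prob_space by simp
  finally interpret D: prob_space D by (intro prob_spaceI) simp
  have "char (distr D borel Y) t = char (distr M borel Y) t" for t
  proof -
    have bnd: "integrable M (\<lambda>w. complex_of_real (Z w) * iexp (t * Y w))"
      using bound by (intro integrable_const_bound[where B = 1]) (auto simp: norm_mult)
    have "char (distr D borel Y) t = (CLINT w|D. iexp (t * Y w))"
      by (simp add: char_def integral_distr)
    also have "\<dots> = (CLINT w|M. (1 + Z w) *\<^sub>R iexp (t * Y w))"
      unfolding D_def using pos by (intro integral_density) auto
    also have "\<dots> = (CLINT w|M. iexp (t * Y w) + complex_of_real (Z w) * iexp (t * Y w))"
      by (intro Bochner_Integration.integral_cong) (auto simp: scaleR_conv_of_real algebra_simps)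
    also have "\<dots> = (CLINT w|M. iexp (t * Y w))"
      using bnd zero[of t] by (subst Bochner_Integration.integral_add)
        (auto intro!: integrable_const_bound[where B = 1])
    finally show ?thesis by (simp add: char_def integral_distr)
  qed
  then have "distr D borel Y = distr M borel Y"
    by (intro Levy_uniqueness D.real_distribution_distr real_distribution_distr ext) auto
  then have "measure (distr D borel Y) B = measure (distr M borel Y) B" by simp
  then have "measure D (Y -` B \<inter> space M) = prob (Y -` B \<inter> space M)"
    by (simp add: measure_distr) (simp add: D_def)
  moreover have "measure D (Y -` B \<inter> space M)
      = expectation (\<lambda>w. indicator (Y -` B \<inter> space M) w + Z w * indicator B (Y w))"
  proof -
    have "measure D (Y -` B \<inter> space M) = (LINT w|D. indicator (Y -` B \<inter> space M) w)"
      by (subst Bochner_Integration.integral_indicator) (auto simp: D_def)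
    also have "\<dots> = (LINT w|M. (1 + Z w) *\<^sub>R indicator (Y -` B \<inter> space M) w)"
      unfolding D_def using pos by (intro integral_density) auto
    also have "\<dots> = expectation (\<lambda>w. indicator (Y -` B \<inter> space M) w + Z w * indicator B (Y w))"
      by (intro Bochner_Integration.integral_cong) (auto simp: indicator_def)
    finally show ?thesis .
  qed
  moreover have "\<dots> = prob (Y -` B \<inter> space M) + expectation (\<lambda>w. Z w * indicator B (Y w))"
    using bound
    by (subst Bochner_Integration.integral_add)
       (auto intro!: integrable_const_bound[where B = 1] simp: indicator_def)
  ultimately show ?thesis by simp
qed

text \<open>As \<open>Y\<close> is real and \<open>t\<close> may be replaced by \<open>- t\<close>,
  the hypothesis is inherited by the conjugate of \<open>Z\<close>, hence by its real and imaginary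
  parts, to which the real case applies.\<close>

lemma (in prob_space) complex_integral_indicator_eq_0:
  fixes Z :: "'a \<Rightarrow> complex"
  assumes [measurable]: "Y \<in> borel_measurable M" "Z \<in> borel_measurable M" "B \<in> sets borel"
    and bound: "\<And>w. norm (Z w) \<le> 1"
    and zero: "\<And>t. (CLINT w|M. Z w * iexp (t * Y w)) = 0"
  shows "(CLINT w|M. Z w * indicator B (Y w)) = 0"
proof -
  have int: "integrable M (\<lambda>w. Z w * iexp (t * Y w))" for t
    using bound by (intro integrable_const_bound[where B = 1]) (auto simp: norm_mult)
  have zero': "(CLINT w|M. cnj (Z w) * iexp (t * Y w)) = 0" for t
  proof -
    have "(CLINT w|M. cnj (Z w) * iexp (t * Y w)) = (CLINT w|M. cnj (Z w * iexp ((- t) * Y w)))"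
      by (intro Bochner_Integration.integral_cong) (auto simp: exp_cnj)
    also have "\<dots> = cnj (CLINT w|M. Z w * iexp ((- t) * Y w))" by (rule Bochner_Integration.integral_cnj)
    finally show ?thesis using zero[of "-t"] by simp
  qed
  have int': "integrable M (\<lambda>w. cnj (Z w) * iexp (t * Y w))" for t
    using integrable_cnj[OF int[of "-t"]] by (simp add: exp_cnj)
  have re: "expectation (\<lambda>w. Re (Z w) * indicator B (Y w)) = 0"
  proof (rule real_integral_indicator_eq_0)
    fix t
    have "(CLINT w|M. complex_of_real (Re (Z w)) * iexp (t * Y w)) =
       (CLINT w|M. 1/2 * (Z w * iexp (t * Y w) + cnj (Z w) * iexp (t * Y w)))"
      by (intro Bochner_Integration.integral_cong refl)
         (simp add: complex_add_cnj distrib_right[symmetric])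
    also have "\<dots> = 0"
      using zero[of t] zero'[of t]
      by (subst integral_mult_right_zero, subst Bochner_Integration.integral_add[OF int int']) simp
    finally show "(CLINT w|M. complex_of_real (Re (Z w)) * iexp (t * Y w)) = 0" .
  next
    fix w show "\<bar>Re (Z w)\<bar> \<le> 1" using abs_Re_le_cmod[of "Z w"] bound[of w] by linarith
  qed auto
  have im: "expectation (\<lambda>w. Im (Z w) * indicator B (Y w)) = 0"
  proof (rule real_integral_indicator_eq_0)
    fix t
    have "(CLINT w|M. complex_of_real (Im (Z w)) * iexp (t * Y w)) =
       (CLINT w|M. (- \<i> / 2) * (Z w * iexp (t * Y w) - cnj (Z w) * iexp (t * Y w)))"
    proof (intro Bochner_Integration.integral_cong refl)
      fix w
      have "complex_of_real (Im (Z w)) = (- \<i> / 2) * (Z w - cnj (Z w))"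
        by (simp add: complex_eq_iff)
      then show "complex_of_real (Im (Z w)) * iexp (t * Y w) =
          (- \<i> / 2) * (Z w * iexp (t * Y w) - cnj (Z w) * iexp (t * Y w))"
        by (simp only: left_diff_distrib mult.assoc)
    qed
    also have "\<dots> = 0"
      using zero[of t] zero'[of t]
      by (subst integral_mult_right_zero, subst Bochner_Integration.integral_diff[OF int int']) simp
    finally show "(CLINT w|M. complex_of_real (Im (Z w)) * iexp (t * Y w)) = 0" .
  next
    fix w show "\<bar>Im (Z w)\<bar> \<le> 1" using abs_Im_le_cmod[of "Z w"] bound[of w] by linarith
  qed auto
  have "integrable M (\<lambda>w. Z w * indicator B (Y w))"
    using bound by (intro integrable_const_bound[where B = 1]) (auto simp: norm_mult indicator_def)
  moreover have Re_ind: "Re (indicator B y) = indicator B y" and Im_ind: "Im (indicator B y) = 0" for y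
    by (auto simp: indicator_def)
  ultimately have "Re (CLINT w|M. Z w * indicator B (Y w)) = 0" "Im (CLINT w|M. Z w * indicator B (Y w)) = 0"
    using re im by (simp_all flip: integral_Re integral_Im add: Re_ind Im_ind)
  then show ?thesis by (simp add: complex_eq_iff)
qed

text \<open>One exponential at a time is traded for an indicator. The exponential in the new
  coordinate is first absorbed into the weight, which is why \<open>Z\<close> varies in the
  induction; the result, for all \<open>t\<close>, is the hypothesis of the one-dimensional lemma
  with the remaining indicators as part of the weight.\<close>

lemma (in prob_space) complex_integral_prod_indicator_eq_0:
  fixes Z :: "'a \<Rightarrow> complex" and L :: "'k \<Rightarrow> 'a \<Rightarrow> real"
  assumes "finite S"
    and "\<And>k. k \<in> S \<Longrightarrow> L k \<in> borel_measurable M" "\<And>k. k \<in> S \<Longrightarrow> B k \<in> sets borel"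
    and "Z \<in> borel_measurable M" "\<And>w. norm (Z w) \<le> 1"
    and "\<And>a. (CLINT w|M. Z w * iexp (\<Sum>k\<in>S. a k * L k w)) = 0"
  shows "(CLINT w|M. Z w * (\<Prod>k\<in>S. indicator (B k) (L k w))) = 0"
  using assms
proof (induction S arbitrary: Z rule: finite_induct)
  case empty
  then show ?case using empty(5)[of "\<lambda>_. 0"] by simp
next
  case (insert x S)
  have [measurable]: "L x \<in> borel_measurable M" "Z \<in> borel_measurable M" "B x \<in> sets borel"
    using insert.prems by auto
  have [measurable]: "L k \<in> borel_measurable M" "B k \<in> sets borel" if "k \<in> S" for k
    using insert.prems that by auto
  have norm_prod: "norm (\<Prod>k\<in>S. indicator (B k) (L k w) :: complex) \<le> 1" for w
    unfolding prod_norm[symmetric] by (intro prod_le_1) (auto simp: indicator_def)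
  have "(CLINT w|M. (Z w * iexp (t * L x w)) * (\<Prod>k\<in>S. indicator (B k) (L k w))) = 0" for t
  proof (rule insert.IH)
    fix a
    have "(CLINT w|M. Z w * iexp (t * L x w) * iexp (\<Sum>k\<in>S. a k * L k w))
       = (CLINT w|M. Z w * iexp (\<Sum>k\<in>insert x S. (a(x := t)) k * L k w))"
    proof (intro Bochner_Integration.integral_cong refl)
      fix w
      have "(\<Sum>k\<in>S. (a(x := t)) k * L k w) = (\<Sum>k\<in>S. a k * L k w)"
        using insert.hyps by (intro sum.cong) auto
      then show "Z w * iexp (t * L x w) * iexp (\<Sum>k\<in>S. a k * L k w)
          = Z w * iexp (\<Sum>k\<in>insert x S. (a(x := t)) k * L k w)"
        using insert.hyps by (simp add: distrib_left exp_add)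
    qed
    then show "(CLINT w|M. Z w * iexp (t * L x w) * iexp (\<Sum>k\<in>S. a k * L k w)) = 0"
      using insert.prems(5) by simp
  qed (use insert.prems in \<open>auto simp: norm_mult\<close>)
  then have "(CLINT w|M. (Z w * (\<Prod>k\<in>S. indicator (B k) (L k w))) * indicator (B x) (L x w)) = 0"
    using insert.prems(4) norm_prod
    by (intro complex_integral_indicator_eq_0) (auto simp: norm_mult mult_ac intro!: mult_le_one)
  then show ?case using insert.hyps by (simp add: mult_ac)
qed

section \<open>Cylinder events and independence\<close>

definition cylinders :: "'a measure \<Rightarrow> ('k \<Rightarrow> 'a \<Rightarrow> real) \<Rightarrow> 'k set \<Rightarrow> 'a set set" where
  "cylinders M L I = {{w \<in> space M. \<forall>k\<in>T. L k w \<in> B k} | T B.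
     finite T \<and> T \<subseteq> I \<and> (\<forall>k. B k \<in> sets borel)}"

lemma cylinders_subset: "cylinders M L I \<subseteq> Pow (space M)"
  by (auto simp: cylinders_def)

lemma Int_stable_cylinders: "Int_stable (cylinders M L I)"
proof (rule Int_stableI)
  fix a b assume "a \<in> cylinders M L I" "b \<in> cylinders M L I"
  then obtain T B T' B' where
    a: "a = {w \<in> space M. \<forall>k\<in>T. L k w \<in> B k}" "finite T" "T \<subseteq> I" "\<forall>k. B k \<in> sets borel" and
    b: "b = {w \<in> space M. \<forall>k\<in>T'. L k w \<in> B' k}" "finite T'" "T' \<subseteq> I" "\<forall>k. B' k \<in> sets borel"
    unfolding cylinders_def by blast
  \<comment> \<open>Each family of sets is padded with the whole line outside its own index
    set.\<close>
  define C where "C k = (if k \<in> T then B k else UNIV) \<inter> (if k \<in> T' then B' k else UNIV)" for k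
  have "a \<inter> b = {w \<in> space M. \<forall>k\<in>T \<union> T'. L k w \<in> C k}"
    unfolding a b C_def by auto
  moreover have "\<forall>k. C k \<in> sets borel" using a b by (auto simp: C_def)
  moreover have "finite (T \<union> T')" "T \<union> T' \<subseteq> I" using a b by auto
  ultimately show "a \<inter> b \<in> cylinders M L I"
    unfolding cylinders_def by (intro CollectI exI[of _ "T \<union> T'"] exI[of _ C]) simp
qed

abbreviation cyl_algebra :: "'a measure \<Rightarrow> ('k \<Rightarrow> 'a \<Rightarrow> real) \<Rightarrow> 'k set \<Rightarrow> 'a measure" where
  "cyl_algebra M L I \<equiv> sigma (space M) (cylinders M L I)"

lemma measurable_cyl_algebra:
  assumes "k \<in> I"
  shows "L k \<in> borel_measurable (cyl_algebra M L I)"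
proof (rule measurableI)
  fix A :: "real set" assume A: "A \<in> sets borel"
  have "L k -` A \<inter> space M = {w \<in> space M. \<forall>k\<in>{k}. L k w \<in> A}" by auto
  also have "\<dots> \<in> cylinders M L I"
    unfolding cylinders_def using assms A by (intro CollectI exI[of _ "{k}"] exI[of _ "\<lambda>_. A"]) auto
  finally show "L k -` A \<inter> space (cyl_algebra M L I) \<in> sets (cyl_algebra M L I)"
    by (auto simp: cylinders_subset)
qed simp

text \<open>Kac's criterion. The joint characteristic function is inverted one coordinate at a time, so that
  only the uniqueness theorem on the real line is needed.\<close>

lemma (in prob_space) indep_set_of_char:
  fixes X :: "'a \<Rightarrow> real" and L :: "'k \<Rightarrow> 'a \<Rightarrow> real"
  assumes [measurable]: "X \<in> borel_measurable M" "\<And>k. k \<in> I \<Longrightarrow> L k \<in> borel_measurable M"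
    and fact: "\<And>T a s. finite T \<Longrightarrow> T \<subseteq> I \<Longrightarrow>
      (CLINT w|M. iexp (s * X w) * iexp (\<Sum>k\<in>T. a k * L k w)) =
      (CLINT w|M. iexp (s * X w)) * (CLINT w|M. iexp (\<Sum>k\<in>T. a k * L k w))"
  shows "indep_set {X -` B \<inter> space M | B. B \<in> sets borel} (cylinders M L I)"
proof (rule indep_setI)
  have cyl_ev: "{w \<in> space M. \<forall>k\<in>T. L k w \<in> B k} \<in> events"
    if "finite T" "T \<subseteq> I" "\<forall>k. B k \<in> sets borel" for T B
  proof -
    have "{w \<in> space M. L k w \<in> B k} \<in> events" if "k \<in> T" for k
    proof -
      have [measurable]: "L k \<in> borel_measurable M" "B k \<in> sets borel"
        using that \<open>T \<subseteq> I\<close> \<open>\<forall>k. B k \<in> sets borel\<close> by auto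
      show ?thesis by measurable
    qed
    then show ?thesis using \<open>finite T\<close> by (intro sets.sets_Collect_finite_All) auto
  qed
  then show "cylinders M L I \<subseteq> events" by (auto simp: cylinders_def)
  show "{X -` B \<inter> space M | B. B \<in> sets borel} \<subseteq> events" by auto
  fix a b assume "a \<in> {X -` B \<inter> space M | B. B \<in> sets borel}" "b \<in> cylinders M L I"
  then obtain C T B where a: "a = X -` C \<inter> space M" and [measurable]: "C \<in> sets borel"
    and b: "b = {w \<in> space M. \<forall>k\<in>T. L k w \<in> B k}" "finite T" "T \<subseteq> I" "\<forall>k. B k \<in> sets borel"
    unfolding cylinders_def by blast
  have [measurable]: "b \<in> events" using cyl_ev b by auto
  have LT [measurable]: "L k \<in> borel_measurable M" if "k \<in> T" for k using that b by auto
  have prod_ind: "(\<Prod>k\<in>T. indicator (B k) (L k w)) = complex_of_real (indicator b w)"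
    if "w \<in> space M" for w
  proof (cases "\<forall>k\<in>T. L k w \<in> B k")
    case True
    then show ?thesis using that by (simp add: b(1))
  next
    case False
    then have "(\<Prod>k\<in>T. indicator (B k) (L k w) :: complex) = 0"
      using b(2) by (intro prod_zero) (auto simp: indicator_def)
    then show ?thesis using False by (simp add: b(1))
  qed
  have factb: "(CLINT w|M. iexp (s * X w) * complex_of_real (indicator b w)) =
      (CLINT w|M. iexp (s * X w)) * complex_of_real (prob b)" for s
  proof -
    define c where "c = (CLINT w|M. iexp (s * X w))"
    have "norm c \<le> expectation (\<lambda>w. norm (iexp (s * X w)))"
      unfolding c_def by (rule integral_norm_bound)
    then have c: "norm c \<le> 1" by (simp add: prob_space)
    have i1: "integrable M (\<lambda>w. iexp (s * X w) * iexp (\<Sum>k\<in>T. a k * L k w))" for a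
      by (intro integrable_const_bound[where B = 1]) (auto simp: norm_mult)
    have i2: "integrable M (\<lambda>w. iexp (\<Sum>k\<in>T. a k * L k w))" for a
      by (intro integrable_const_bound[where B = 1]) auto
    \<comment> \<open>First inversion, in the coordinates \<open>L\<close>. Subtracting the mean
      \<open>c\<close> makes the weight orthogonal to all exponentials in \<open>L\<close>; halving
      it keeps its norm at most one.\<close>
    have "(CLINT w|M. ((iexp (s * X w) - c) / 2) * (\<Prod>k\<in>T. indicator (B k) (L k w))) = 0"
    proof (rule complex_integral_prod_indicator_eq_0)
      fix w
      have "norm (iexp (s * X w) - c) \<le> 2" using norm_triangle_ineq4[of "iexp (s * X w)" c] c by simp
      then show "norm ((iexp (s * X w) - c) / 2) \<le> 1" by (simp add: norm_divide)
    next
      fix a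
      have "(CLINT w|M. (iexp (s * X w) - c) / 2 * iexp (\<Sum>k\<in>T. a k * L k w))
        = (CLINT w|M. 1/2 * (iexp (s * X w) * iexp (\<Sum>k\<in>T. a k * L k w) - c * iexp (\<Sum>k\<in>T. a k * L k w)))"
        by (intro Bochner_Integration.integral_cong refl) (simp add: left_diff_distrib diff_divide_distrib)
      also have "\<dots> = 0" unfolding c_def
        by (subst integral_mult_right_zero, subst Bochner_Integration.integral_diff)
           (use i1 i2 fact b in auto)
      finally show "(CLINT w|M. (iexp (s * X w) - c) / 2 * iexp (\<Sum>k\<in>T. a k * L k w)) = 0" .
    qed (use b in auto)
    also have "(CLINT w|M. ((iexp (s * X w) - c) / 2) * (\<Prod>k\<in>T. indicator (B k) (L k w)))
       = (CLINT w|M. 1/2 * (iexp (s * X w) * complex_of_real (indicator b w) - c * complex_of_real (indicator b w)))"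
      by (intro Bochner_Integration.integral_cong refl)
         (simp add: prod_ind left_diff_distrib diff_divide_distrib)
    also have "\<dots> = 1/2 * ((CLINT w|M. iexp (s * X w) * complex_of_real (indicator b w)) - c * complex_of_real (prob b))"
    proof -
      have "integrable M (\<lambda>w. iexp (s * X w) * complex_of_real (indicator b w))"
        by (intro integrable_const_bound[where B = 1]) (auto simp: norm_mult indicator_def)
      moreover have "integrable M (\<lambda>w. c * complex_of_real (indicator b w))"
        by (intro integrable_mult_right integrable_const_bound[where B = 1]) (auto simp: indicator_def)
      ultimately show ?thesis
        by (subst integral_mult_right_zero, subst Bochner_Integration.integral_diff)
           (auto simp: integral_complex_of_real)
    qed
    finally show ?thesis by (simp add: c_def)
  qed
  \<comment> \<open>Second inversion, now in \<open>X\<close>, with the centred indicator of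
    \<open>b\<close> as weight.\<close>
  have "expectation (\<lambda>w. (indicator b w - prob b) * indicator C (X w)) = 0"
  proof (rule real_integral_indicator_eq_0)
    fix s
    have "integrable M (\<lambda>w. iexp (s * X w) * complex_of_real (indicator b w))"
      by (intro integrable_const_bound[where B = 1]) (auto simp: norm_mult indicator_def)
    moreover have "integrable M (\<lambda>w. iexp (s * X w) * complex_of_real (prob b))"
      by (intro integrable_mult_left integrable_const_bound[where B = 1]) auto
    ultimately have "(CLINT w|M. iexp (s * X w) * complex_of_real (indicator b w) - iexp (s * X w) * complex_of_real (prob b)) = 0"
      using factb[of s] by (subst Bochner_Integration.integral_diff) auto
    then show "(CLINT w|M. complex_of_real (indicator b w - prob b) * iexp (s * X w)) = 0"
      by (simp add: algebra_simps)
  next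
    fix w show "\<bar>indicator b w - prob b\<bar> \<le> 1"
      using prob_le_1[of b] measure_nonneg[of M b] by (auto simp: indicator_def)
  qed auto
  moreover have "expectation (\<lambda>w. (indicator b w - prob b) * indicator C (X w))
     = expectation (\<lambda>w. indicator (a \<inter> b) w - prob b * indicator a w)"
    by (intro Bochner_Integration.integral_cong refl) (auto simp: a indicator_def)
  moreover have "\<dots> = prob (a \<inter> b) - prob b * prob a"
  proof -
    have [measurable]: "a \<in> events" by (simp add: a)
    show ?thesis by (subst Bochner_Integration.integral_diff) (auto simp: less_top[symmetric])
  qed
  ultimately show "prob (a \<inter> b) = prob a * prob b" by simp
qed

text \<open>Both generating families are stable under intersection, so independence passes to the
  sigma-algebras they generate, and these make \<open>W\<close> and \<open>g (X w)\<close>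
  measurable.\<close>

lemma (in prob_space) expectation_mult_cyl_algebra:
  fixes W :: "'a \<Rightarrow> real"
  assumes ind: "indep_set {X -` B \<inter> space M | B. B \<in> sets borel} (cylinders M L I)"
    and X: "X \<in> borel_measurable M"
    and W: "W \<in> borel_measurable (cyl_algebra M L I)" "integrable M W"
    and g: "g \<in> borel_measurable borel" "integrable M (\<lambda>w. g (X w))"
  shows "expectation (\<lambda>w. W w * g (X w)) = expectation W * expectation (\<lambda>w. g (X w))"
proof (rule indep_var_lebesgue_integral)
  let ?A = "{X -` B \<inter> space M | B. B \<in> sets borel}"
  have "indep_set (sigma_sets (space M) (cylinders M L I)) (sigma_sets (space M) ?A)"
  proof (rule indep_set_sigma_sets)
    show "indep_set (cylinders M L I) ?A"
    proof (rule indep_setI)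
      fix a b assume "a \<in> cylinders M L I" "b \<in> ?A"
      from indep_setD[OF ind this(2,1)] show "prob (a \<inter> b) = prob a * prob b"
        by (simp only: Int_commute[of b] mult.commute[of "prob b"])
    qed (use ind in \<open>auto simp: indep_sets2_eq\<close>)
    show "Int_stable ?A"
    proof (rule Int_stableI)
      fix a b assume "a \<in> ?A" "b \<in> ?A"
      then obtain B C where "a = X -` B \<inter> space M" "b = X -` C \<inter> space M" "B \<in> sets borel" "C \<in> sets borel" by blast
      then have "a \<inter> b = X -` (B \<inter> C) \<inter> space M" "B \<inter> C \<in> sets borel" by auto
      then show "a \<inter> b \<in> ?A" by blast
    qed
  qed (rule Int_stable_cylinders)
  then have ind': "indep_set (sets (cyl_algebra M L I)) (sigma_sets (space M) ?A)"
    by (simp add: cylinders_subset)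
  have sub: "sigma_sets (space M) {W -` A \<inter> space M | A. A \<in> sets borel} \<subseteq> sets (cyl_algebra M L I)"
  proof (subst sets_measure_of[OF cylinders_subset], rule sigma_sets_mono, safe)
    fix A :: "real set" assume "A \<in> sets borel"
    from measurable_sets[OF W(1) this] show "W -` A \<inter> space M \<in> sigma_sets (space M) (cylinders M L I)"
      by (simp add: cylinders_subset)
  qed
  have sub2: "sigma_sets (space M) {(\<lambda>w. g (X w)) -` A \<inter> space M | A. A \<in> sets borel} \<subseteq> sigma_sets (space M) ?A"
  proof (rule sigma_sets_mono, safe)
    fix A :: "real set" assume "A \<in> sets borel"
    then have "g -` A \<in> sets borel" using measurable_sets[OF g(1), of A] by simp
    moreover have "(\<lambda>w. g (X w)) -` A \<inter> space M = X -` (g -` A) \<inter> space M" by auto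
    ultimately show "(\<lambda>w. g (X w)) -` A \<inter> space M \<in> sigma_sets (space M) ?A" by (intro sigma_sets.Basic) auto
  qed
  show "indep_var borel W borel (\<lambda>w. g (X w))"
    unfolding indep_var_eq
  proof (intro conjI)
    show "indep_set (sigma_sets (space M) {W -` A \<inter> space M |A. A \<in> sets borel})
      (sigma_sets (space M) {(\<lambda>w. g (X w)) -` A \<inter> space M |A. A \<in> sets borel})"
      using ind' sub sub2 unfolding indep_sets2_eq by (meson subset_trans subsetD)
  qed (rule borel_measurable_integrable[OF W(2)] borel_measurable_integrable[OF g(2)])+
qed (rule W(2) g(2))+

section \<open>Centred Gaussian variables and their span\<close>

lemma (in prob_space) centered_gaussian_rv_cases:
  assumes "gaussian_rv M X" "expectation X = 0"
  obtains (normal) \<sigma> where "0 < \<sigma>" "distributed M lborel X (normal_density 0 \<sigma>)"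
  | (zero) "AE w in M. X w = 0"
proof -
  from assms(1) have X: "X \<in> borel_measurable M" by (simp add: gaussian_rv_def)
  from assms(1) consider (a) \<mu> \<sigma> where "0 < \<sigma>" "distributed M lborel X (normal_density \<mu> \<sigma>)"
    | (b) \<mu> where "AE w in M. X w = \<mu>"
    unfolding gaussian_rv_def by blast
  then show thesis
  proof cases
    case (a \<mu> \<sigma>)
    have "\<mu> = 0" using normal_distributed_expectation[OF a] assms(2) by simp
    with a(2) have "distributed M lborel X (normal_density 0 \<sigma>)" by simp
    with a(1) show thesis by (rule normal)
  next
    case (b \<mu>)
    then have "expectation X = expectation (\<lambda>_. \<mu>)" using X by (intro integral_cong_AE) auto
    then have "\<mu> = 0" using assms(2) prob_space by simp
    with b have "AE w in M. X w = 0" by simp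
    then show thesis by (rule zero)
  qed
qed

lemma (in prob_space) centered_gaussian_rv_square_integrable:
  assumes "gaussian_rv M X" "expectation X = 0"
  shows "integrable M (\<lambda>w. (X w)\<^sup>2)"
  using assms
proof (cases rule: centered_gaussian_rv_cases)
  case (normal \<sigma>)
  have "integrable lborel (\<lambda>x. normal_density 0 \<sigma> x * (x - 0)\<^sup>2)"
    using normal by (intro integrable_normal_moment)
  then show ?thesis
    using distributed_integrable[OF normal(2), of "\<lambda>x. x\<^sup>2"] by simp
next
  case zero
  then have "AE w in M. (X w)\<^sup>2 = 0" by auto
  then show ?thesis
    using assms(1) unfolding gaussian_rv_def by (subst integrable_cong_AE[where g = "\<lambda>_. 0"]) auto
qed

text \<open>The point mass at zero obeys the same formula with variance zero, so degenerate linear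
  combinations need no separate treatment later.\<close>

lemma (in prob_space) centered_gaussian_rv_char:
  assumes "gaussian_rv M X" "expectation X = 0"
  shows "(CLINT w|M. iexp (X w)) = complex_of_real (exp (- expectation (\<lambda>w. (X w)\<^sup>2) / 2))"
  using assms
proof (cases rule: centered_gaussian_rv_cases)
  case (normal \<sigma>)
  have [measurable]: "X \<in> borel_measurable M" using assms by (simp add: gaussian_rv_def)
  have D: "distributed M lborel (\<lambda>w. X w / \<sigma>) std_normal_density"
    using normal normal_standard_normal_convert[of \<sigma> X 0] by simp
  have "distr M borel (\<lambda>w. X w / \<sigma>) = distr M lborel (\<lambda>w. X w / \<sigma>)"
    by (intro distr_cong) auto
  also have "\<dots> = std_normal_distribution" by (rule distributed_distr_eq_density[OF D])
  finally have "char (distr M borel (\<lambda>w. X w / \<sigma>)) \<sigma> = complex_of_real (exp (- (\<sigma>\<^sup>2) / 2))"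
    by (simp add: char_std_normal_distribution)
  then have "(CLINT w|M. iexp (X w)) = complex_of_real (exp (- (\<sigma>\<^sup>2) / 2))"
    using normal by (simp add: char_def integral_distr)
  moreover have "expectation (\<lambda>w. (X w)\<^sup>2) = \<sigma>\<^sup>2"
    using normal_distributed_variance[OF normal] assms by simp
  ultimately show ?thesis by simp
next
  case zero
  have [measurable]: "X \<in> borel_measurable M" using assms by (simp add: gaussian_rv_def)
  have "(CLINT w|M. iexp (X w)) = (CLINT w|M. 1)"
    using zero by (intro integral_cong_AE) auto
  moreover have "expectation (\<lambda>w. (X w)\<^sup>2) = expectation (\<lambda>w. 0)"
    using zero by (intro integral_cong_AE) auto
  ultimately show ?thesis by (simp add: prob_space)
qed

locale centered_gaussian_field = prob_space M for M :: "'w measure" +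
  fixes f :: "'i \<Rightarrow> 'w \<Rightarrow> real"
  assumes gaussian: "gaussian_field M f"
    and centered: "\<And>x. expectation (f x) = 0"
begin

text \<open>The Gaussian Hilbert space of the field before completion: all its elements are centred
  Gaussian.\<close>

definition lin_span :: "('w \<Rightarrow> real) set" where
  "lin_span = {(\<lambda>w. \<Sum>x\<in>S. a x * f x w) | S a. finite S}"

lemma lin_span_sum: "finite S \<Longrightarrow> (\<lambda>w. \<Sum>x\<in>S. a x * f x w) \<in> lin_span"
  by (auto simp: lin_span_def)

lemma lin_span_single: "f x \<in> lin_span"
  using lin_span_sum[of "{x}" "\<lambda>_. 1"] by simp

lemma lin_span_add:
  assumes "X \<in> lin_span" "Y \<in> lin_span"
  shows "(\<lambda>w. X w + Y w) \<in> lin_span"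
proof -
  obtain S a T b where X: "X = (\<lambda>w. \<Sum>x\<in>S. a x * f x w)" "finite S"
    and Y: "Y = (\<lambda>w. \<Sum>x\<in>T. b x * f x w)" "finite T"
    using assms by (auto simp: lin_span_def)
  have "X w + Y w = (\<Sum>x\<in>S \<union> T. ((if x \<in> S then a x else 0) + (if x \<in> T then b x else 0)) * f x w)" for w
  proof -
    have "X w = (\<Sum>x\<in>S \<union> T. (if x \<in> S then a x else 0) * f x w)"
      unfolding X using X Y by (intro sum.mono_neutral_cong_left) auto
    moreover have "Y w = (\<Sum>x\<in>S \<union> T. (if x \<in> T then b x else 0) * f x w)"
      unfolding Y using X Y by (intro sum.mono_neutral_cong_left) auto
    ultimately show ?thesis by (simp add: sum.distrib distrib_right)
  qed
  then show ?thesis using X Y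
    lin_span_sum[of "S \<union> T" "\<lambda>x. (if x \<in> S then a x else 0) + (if x \<in> T then b x else 0)"] by simp
qed

lemma lin_span_scale:
  assumes "X \<in> lin_span"
  shows "(\<lambda>w. c * X w) \<in> lin_span"
proof -
  obtain S a where X: "X = (\<lambda>w. \<Sum>x\<in>S. a x * f x w)" "finite S"
    using assms by (auto simp: lin_span_def)
  then show ?thesis using lin_span_sum[of S "\<lambda>x. c * a x"]
    by (simp add: sum_distrib_left mult.assoc)
qed

lemma gaussian_lin_span: "X \<in> lin_span \<Longrightarrow> gaussian_rv M X"
  using gaussian by (auto simp: lin_span_def gaussian_field_def)

lemma measurable_lin_span: "X \<in> lin_span \<Longrightarrow> X \<in> borel_measurable M"
  using gaussian_lin_span by (auto simp: gaussian_rv_def)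

lemma measurable_field [measurable]: "f x \<in> borel_measurable M"
  by (intro measurable_lin_span lin_span_single)

lemma integrable_field: "integrable M (f x)"
  by (rule square_integrable_imp_integrable[OF measurable_field
        centered_gaussian_rv_square_integrable[OF gaussian_lin_span[OF lin_span_single] centered]])

lemma lin_span_centered: "X \<in> lin_span \<Longrightarrow> expectation X = 0"
  by (auto simp: lin_span_def centered integrable_field)

lemma integrable_square_lin_span: "X \<in> lin_span \<Longrightarrow> integrable M (\<lambda>w. (X w)\<^sup>2)"
  by (rule centered_gaussian_rv_square_integrable[OF gaussian_lin_span lin_span_centered])

lemma integrable_mult_lin_span:
  assumes "X \<in> lin_span" "Y \<in> lin_span"
  shows "integrable M (\<lambda>w. X w * Y w)"
proof (rule Bochner_Integration.integrable_bound)
  show "integrable M (\<lambda>w. (X w)\<^sup>2 + (Y w)\<^sup>2)"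
    using assms by (intro Bochner_Integration.integrable_add integrable_square_lin_span)
  have "\<bar>X w * Y w\<bar> \<le> (X w)\<^sup>2 + (Y w)\<^sup>2" for w
  proof -
    have "2 * \<bar>X w * Y w\<bar> \<le> (X w)\<^sup>2 + (Y w)\<^sup>2"
      using sum_squares_bound[of "\<bar>X w\<bar>" "\<bar>Y w\<bar>"] by (simp add: abs_mult)
    then show ?thesis by linarith
  qed
  then show "AE w in M. norm (X w * Y w) \<le> norm ((X w)\<^sup>2 + (Y w)\<^sup>2)" by simp
qed (use assms measurable_lin_span in \<open>auto intro!: borel_measurable_times\<close>)

text \<open>The characteristic function of an element of the span depends on its variance only.
  Orthogonality makes the variances of \<open>X'\<close> and \<open>Y\<close> add up, so the
  characteristic function of the sum factorises.\<close>

lemma indep_set_lin_span: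
  assumes X: "X \<in> lin_span" and orth: "\<And>k. k \<in> I \<Longrightarrow> expectation (\<lambda>w. X w * f k w) = 0"
  shows "indep_set {X -` B \<inter> space M | B. B \<in> sets borel} (cylinders M f I)"
proof (rule indep_set_of_char)
  fix T a s assume T: "finite T" "T \<subseteq> I"
  define Y where "Y w = (\<Sum>k\<in>T. a k * f k w)" for w
  define X' where "X' w = s * X w" for w
  have Y: "Y \<in> lin_span" unfolding Y_def by (rule lin_span_sum) fact
  have X': "X' \<in> lin_span" unfolding X'_def by (intro lin_span_scale X)
  note sq = integrable_square_lin_span
  have "expectation (\<lambda>w. X w * Y w) = expectation (\<lambda>w. \<Sum>k\<in>T. a k * (X w * f k w))"
    unfolding Y_def sum_distrib_left by (simp add: mult_ac)
  also have "\<dots> = (\<Sum>k\<in>T. expectation (\<lambda>w. a k * (X w * f k w)))"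
    by (rule Bochner_Integration.integral_sum)
       (intro integrable_mult_right integrable_mult_lin_span X lin_span_single)
  also have "\<dots> = 0" using T by (intro sum.neutral) (auto simp: orth)
  finally have XY: "expectation (\<lambda>w. X' w * Y w) = 0" by (simp add: X'_def mult.assoc)
  have "expectation (\<lambda>w. (X' w + Y w)\<^sup>2) = expectation (\<lambda>w. ((X' w)\<^sup>2 + (Y w)\<^sup>2) + 2 * (X' w * Y w))"
    by (intro Bochner_Integration.integral_cong refl) (simp add: power2_sum)
  also have "\<dots> = expectation (\<lambda>w. (X' w)\<^sup>2) + expectation (\<lambda>w. (Y w)\<^sup>2)"
    using X' Y XY by (simp add: sq integrable_mult_lin_span)
  finally have V: "expectation (\<lambda>w. (X' w + Y w)\<^sup>2) = expectation (\<lambda>w. (X' w)\<^sup>2) + expectation (\<lambda>w. (Y w)\<^sup>2)" .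
  note ch = centered_gaussian_rv_char[OF gaussian_lin_span lin_span_centered]
  have "(CLINT w|M. iexp (X' w) * iexp (Y w)) = (CLINT w|M. iexp (X' w + Y w))"
    by (simp add: exp_add distrib_left)
  also have "\<dots> = complex_of_real (exp (- (expectation (\<lambda>w. (X' w)\<^sup>2) + expectation (\<lambda>w. (Y w)\<^sup>2)) / 2))"
    by (subst ch[OF lin_span_add[OF X' Y] lin_span_add[OF X' Y]]) (simp only: V)
  also have "\<dots> = (CLINT w|M. iexp (X' w)) * (CLINT w|M. iexp (Y w))"
    unfolding ch[OF X' X'] ch[OF Y Y]
    by (simp only: of_real_mult[symmetric] exp_add[symmetric] add_divide_distrib minus_add_distrib)
  finally show "(CLINT w|M. iexp (s * X w) * iexp (\<Sum>k\<in>T. a k * f k w)) =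
      (CLINT w|M. iexp (s * X w)) * (CLINT w|M. iexp (\<Sum>k\<in>T. a k * f k w))"
    by (simp add: X'_def Y_def)
qed (use X measurable_lin_span in auto)

end

section \<open>Components of level sets\<close>

definition lattice_steps :: "(int ^ 'd) set \<Rightarrow> (int ^ 'd) rel" where
  "lattice_steps S = {(u, v). u \<in> S \<and> v \<in> S \<and> lattice_adj u v}"

text \<open>Empty for \<open>a\<close> outside \<open>S\<close>, since \<open>joined_in S\<close>
  relates points of \<open>S\<close> only.\<close>

definition cluster :: "(int ^ 'd) set \<Rightarrow> int ^ 'd \<Rightarrow> (int ^ 'd) set" where
  "cluster S a = joined_in S `` {a}"

lemma joined_in_iff: "(a, b) \<in> joined_in S \<longleftrightarrow> a \<in> S \<and> b \<in> S \<and> (a, b) \<in> (lattice_steps S)\<^sup>*"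
  by (auto simp: joined_in_def lattice_steps_def)

lemma lattice_steps_mono: "S \<subseteq> T \<Longrightarrow> lattice_steps S \<subseteq> lattice_steps T"
  by (auto simp: lattice_steps_def)

lemma joined_in_mono: "S \<subseteq> T \<Longrightarrow> joined_in S \<subseteq> joined_in T"
  using rtrancl_mono[OF lattice_steps_mono, of S T] by (auto simp: joined_in_iff)

lemma joined_in_step: "u \<in> S \<Longrightarrow> v \<in> S \<Longrightarrow> lattice_adj u v \<Longrightarrow> (u, v) \<in> joined_in S"
  by (auto simp: joined_in_iff lattice_steps_def)

lemma equiv_joined_in: "equiv S (joined_in S)"
proof (rule equivI)
  have "sym (lattice_steps S)"
    by (auto simp: sym_def lattice_steps_def lattice_adj_commute)
  then have "sym ((lattice_steps S)\<^sup>*)" by (rule sym_rtrancl)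
  then show "sym (joined_in S)" by (auto simp: sym_def joined_in_iff)
  show "trans (joined_in S)" by (auto simp: trans_def joined_in_iff)
qed (auto simp: refl_on_def joined_in_iff)

lemma joined_in_sym: "(a, b) \<in> joined_in S \<Longrightarrow> (b, a) \<in> joined_in S"
  using equiv_joined_in by (meson equivE symE)

lemma joined_in_trans: "(a, b) \<in> joined_in S \<Longrightarrow> (b, c) \<in> joined_in S \<Longrightarrow> (a, c) \<in> joined_in S"
  using equiv_joined_in by (meson equivE transE)

lemma mem_cluster_iff: "b \<in> cluster S a \<longleftrightarrow> (a, b) \<in> joined_in S"
  by (simp add: cluster_def)

lemma cluster_self: "a \<in> S \<Longrightarrow> a \<in> cluster S a"
  by (simp add: mem_cluster_iff joined_in_iff)

lemma cluster_eq: "b \<in> cluster S a \<Longrightarrow> cluster S b = cluster S a"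
  unfolding cluster_def using equiv_class_eq[OF equiv_joined_in, of a b S] by auto

lemma cluster_subset: "cluster S a \<subseteq> S"
  by (auto simp: mem_cluster_iff joined_in_iff)

lemma lattice_components_eq: "lattice_components S = cluster S ` S"
  by (auto simp: lattice_components_def quotient_def cluster_def)

lemma cluster_induct [consumes 1, case_names base step]:
  assumes "b \<in> cluster S a"
    and "P a"
    and "\<And>b c. b \<in> cluster S a \<Longrightarrow> c \<in> S \<Longrightarrow> lattice_adj b c \<Longrightarrow> P b \<Longrightarrow> P c"
  shows "P b"
proof -
  from assms(1) have a: "a \<in> S" and r: "(a, b) \<in> (lattice_steps S)\<^sup>*"
    by (auto simp: mem_cluster_iff joined_in_iff)
  from r show ?thesis
  proof (induction rule: rtrancl_induct)
    case (step b c)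
    then have "b \<in> cluster S a" "c \<in> S" "lattice_adj b c"
      using a by (auto simp: mem_cluster_iff joined_in_iff lattice_steps_def)
    then show ?case using step.IH by (rule assms(3))
  qed fact
qed

lemma cluster_step: "b \<in> cluster S a \<Longrightarrow> c \<in> S \<Longrightarrow> lattice_adj b c \<Longrightarrow> c \<in> cluster S a"
  using cluster_subset[of S a] joined_in_step[of b S c] joined_in_trans[of a b S c]
  by (auto simp: mem_cluster_iff)

section \<open>Locality of the counted components\<close>

lemma adj_interior: "x \<in> D \<Longrightarrow> x \<notin> lattice_boundary D \<Longrightarrow> lattice_adj x y \<Longrightarrow> y \<in> D"
  by (auto simp: lattice_boundary_def)

text \<open>A path can leave \<open>D\<close> only from a point of its inner boundary, so a cluster
  that misses the boundary stays inside. Either cluster may be the one known to miss it, which lets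
  the lemma be applied both to restrict and to extend.\<close>

lemma cluster_Int:
  assumes a: "a \<in> S \<inter> D"
    and "cluster S a \<inter> lattice_boundary D = {} \<or> cluster (S \<inter> D) a \<inter> lattice_boundary D = {}"
  shows "cluster S a = cluster (S \<inter> D) a"
proof
  show "cluster (S \<inter> D) a \<subseteq> cluster S a"
    using joined_in_mono[of "S \<inter> D" S] by (auto simp: mem_cluster_iff)
  show "cluster S a \<subseteq> cluster (S \<inter> D) a"
  proof
    fix b assume "b \<in> cluster S a"
    then show "b \<in> cluster (S \<inter> D) a"
    proof (induction rule: cluster_induct)
      case base
      then show ?case using a by (rule cluster_self)
    next
      case (step b c)
      then have "b \<in> D" using cluster_subset by blast
      moreover have "b \<notin> lattice_boundary D" using step assms(2) by blast
      ultimately have "c \<in> D" using step by (blast intro: adj_interior)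
      then have "c \<in> S \<inter> D" using step by blast
      then show ?case using step by (blast intro: cluster_step)
    qed
  qed
qed

text \<open>This reduces the count to the finitely many sites of the box, from which its finiteness
  and measurability follow.\<close>

lemma inner_components_local:
  fixes S :: "(int ^ 'd) set"
  shows "inner_components R S = inner_components R (S \<inter> lattice_box R)"
proof -
  let ?D = "lattice_box R :: (int ^ 'd) set"
  \<comment> \<open>Formulated for two sets with the same trace on the box, so that it yields both
    inclusions.\<close>
  have 1: "C \<in> inner_components R T"
    if C: "C \<in> inner_components R S" and ST: "S \<inter> ?D = T \<inter> ?D" for C S and T :: "(int ^ 'd) set"
  proof -
    from C obtain a' a where C': "C = cluster S a'" and a: "a \<in> C \<inter> ?D"
      and bd: "C \<inter> lattice_boundary ?D = {}"
      by (auto simp: inner_components_def lattice_components_eq)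
    then have Ca: "C = cluster S a" using cluster_eq by blast
    have aS: "a \<in> S \<inter> ?D" using a C' cluster_subset by blast
    have "C = cluster (S \<inter> ?D) a" unfolding Ca
      by (rule cluster_Int[OF aS]) (use bd Ca in blast)
    then have "C = cluster (T \<inter> ?D) a" by (simp add: ST)
    moreover have "cluster T a = cluster (T \<inter> ?D) a"
      by (rule cluster_Int) (use bd aS ST calculation in auto)
    ultimately have "C = cluster T a" by simp
    moreover have "a \<in> T" using aS ST by blast
    ultimately show ?thesis using a bd
      unfolding inner_components_def lattice_components_eq by blast
  qed
  show ?thesis using 1[of _ S "S \<inter> ?D"] 1[of _ "S \<inter> ?D" S] by (auto simp: Int_assoc)
qed

lemma bij_betw_vec_nth_PiE:
  "bij_betw vec_nth {x :: 'a ^ 'd. \<forall>i. x $ i \<in> A} (PiE UNIV (\<lambda>_. A))"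
  by (rule bij_betwI[where g = vec_lambda]) (auto simp: PiE_def)

lemma finite_vec_box: "finite A \<Longrightarrow> finite {x :: 'a ^ 'd. \<forall>i. x $ i \<in> A}"
  using bij_betw_finite[OF bij_betw_vec_nth_PiE[of A, where 'd = 'd]] finite_PiE[of UNIV "\<lambda>_ :: 'd. A"] by simp

lemma card_vec_box: "card {x :: 'a ^ 'd. \<forall>i. x $ i \<in> A} = card A ^ CARD('d)"
  using bij_betw_same_card[OF bij_betw_vec_nth_PiE[of A, where 'd = 'd]] card_PiE[of UNIV "\<lambda>_ :: 'd. A"]
  by simp

lemma lattice_box_eq: "lattice_box R = {x. \<forall>i. x $ i \<in> {\<lceil>- R\<rceil>..\<lfloor>R\<rfloor>}}"
  by (auto simp: lattice_box_def le_floor_iff ceiling_le_iff)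

lemma finite_lattice_box [simp]: "finite (lattice_box R)"
  unfolding lattice_box_eq by (rule finite_vec_box) simp

lemma inner_components_subset: "inner_components R S \<subseteq> Pow (lattice_box R)"
  unfolding inner_components_local[of R S]
  using cluster_subset by (auto simp: inner_components_def lattice_components_eq)

lemma finite_inner_components [simp]: "finite (inner_components R S)"
  by (rule finite_subset[OF inner_components_subset]) simp

lemma card_inner_components_le:
  "card (inner_components R (S :: (int ^ 'd) set)) \<le> card (Pow (lattice_box R :: (int ^ 'd) set))"
  by (intro card_mono inner_components_subset) simp

lemma N_total_local:
  "N_total R l h = card (inner_components R {y \<in> lattice_box R. h y > l})
    + card (inner_components R {y \<in> lattice_box R. h y < l})"
  unfolding N_total_def N_plus_def N_minus_def
  by (subst (1 2) inner_components_local) (simp add: Int_def conj_commute)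

section \<open>Adding one site to a set\<close>

lemma lattice_components_insert_isolated:
  assumes x: "x \<notin> S" and iso: "nbrs x \<inter> S = {}"
  shows "lattice_components (insert x S) = insert {x} (lattice_components S)"
proof -
  \<comment> \<open>An isolated point brings no new edge, so no old cluster can change.\<close>
  have steps: "lattice_steps (insert x S) = lattice_steps S"
    using iso by (auto simp: lattice_steps_def nbrs_def lattice_adj_commute)
      (simp_all add: lattice_adj_def)
  have "cluster (insert x S) x = {x}"
  proof -
    have "b = x" if "b \<in> cluster (insert x S) x" for b
      using that
    proof (induction rule: cluster_induct)
      case (step b c)
      then have "(x, c) \<in> lattice_steps (insert x S)" by (auto simp: lattice_steps_def)
      then show ?case using x unfolding steps by (auto simp: lattice_steps_def)
    qed simp
    then show ?thesis using cluster_self[of x "insert x S"] by auto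
  qed
  moreover have "cluster (insert x S) a = cluster S a" if a: "a \<in> S" for a
  proof -
    have "b \<in> cluster S a" if "b \<in> cluster (insert x S) a" for b
      using that
    proof (induction rule: cluster_induct)
      case base
      then show ?case using a by (rule cluster_self)
    next
      case (step b c)
      then have "(b, c) \<in> lattice_steps (insert x S)"
        using cluster_subset[of S a] by (auto simp: lattice_steps_def)
      then have "c \<in> S" unfolding steps by (auto simp: lattice_steps_def)
      then show ?case using step by (blast intro: cluster_step)
    qed
    moreover have "cluster S a \<subseteq> cluster (insert x S) a"
      using joined_in_mono[OF subset_insertI, of S x] by (auto simp: mem_cluster_iff)
    ultimately show ?thesis by blast
  qed
  ultimately show ?thesis by (simp add: lattice_components_eq)
qed

lemma card_inner_components_insert_isolated:
  assumes "x \<notin> S" "nbrs x \<inter> S = {}" "x \<in> lattice_box R" "x \<notin> lattice_boundary (lattice_box R)"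
  shows "card (inner_components R (insert x S)) = card (inner_components R S) + 1"
proof -
  have "inner_components R (insert x S) = insert {x} (inner_components R S)"
    unfolding inner_components_def lattice_components_insert_isolated[OF assms(1,2)]
    using assms by auto
  moreover have "{x} \<notin> inner_components R S"
    using assms(1) cluster_subset by (fastforce simp: inner_components_def lattice_components_eq)
  ultimately show ?thesis by simp
qed

text \<open>A path through \<open>x\<close> enters and leaves by neighbours that are already joined
  in \<open>S\<close>, so it can be rerouted around \<open>x\<close>.\<close>

lemma cluster_insert_noncut:
  assumes x: "x \<notin> S" and nb: "nbrs x \<subseteq> S"
    and conn: "\<And>u v. u \<in> nbrs x \<Longrightarrow> v \<in> nbrs x \<Longrightarrow> (u, v) \<in> joined_in S"
    and a: "a \<in> S"
  shows "cluster (insert x S) a - {x} = cluster S a"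
proof
  show "cluster S a \<subseteq> cluster (insert x S) a - {x}"
    using joined_in_mono[OF subset_insertI, of S x] cluster_subset[of S a] x by (auto simp: mem_cluster_iff)
  \<comment> \<open>When the path sits at \<open>x\<close>, the invariant records that all
    neighbours of \<open>x\<close> have been reached; this is what the next step out of
    \<open>x\<close> needs.\<close>
  have "(b \<noteq> x \<longrightarrow> b \<in> cluster S a) \<and> (b = x \<longrightarrow> nbrs x \<subseteq> cluster S a)"
    if "b \<in> cluster (insert x S) a" for b
    using that
  proof (induction rule: cluster_induct)
    case base
    then show ?case using a x cluster_self by auto
  next
    case (step b c)
    show ?case
    proof (cases "b = x")
      case True
      then show ?thesis using step by (auto simp: nbrs_def lattice_adj_def)
    next
      case False
      then have b: "b \<in> cluster S a" using step by simp
      show ?thesis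
      proof (cases "c = x")
        case True
        then have "b \<in> nbrs x" using step by (simp add: nbrs_def lattice_adj_commute)
        then have "v \<in> cluster S a" if "v \<in> nbrs x" for v
          using b conn[OF _ that] joined_in_trans[of a b S v] by (simp add: mem_cluster_iff)
        then show ?thesis using True by blast
      next
        case False
        then show ?thesis using b step by (auto intro: cluster_step)
      qed
    qed
  qed
  then show "cluster (insert x S) a - {x} \<subseteq> cluster S a" by blast
qed

text \<open>Deleting \<open>x\<close> is a bijection between the components of the two sets, and it
  respects the two conditions for being counted because \<open>x\<close> is an interior point of the
  box.\<close>

lemma card_inner_components_insert_noncut:
  assumes x: "x \<notin> S" and nb: "nbrs x \<subseteq> S"
    and conn: "\<And>u v. u \<in> nbrs x \<Longrightarrow> v \<in> nbrs x \<Longrightarrow> (u, v) \<in> joined_in S"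
    and box: "x \<in> lattice_box R" "x \<notin> lattice_boundary (lattice_box R)"
  shows "card (inner_components R (insert x S)) = card (inner_components R S)"
proof -
  let ?D = "lattice_box R" and ?S' = "insert x S"
  obtain n where n: "n \<in> nbrs x" using nbrs_nonempty by blast
  have nS: "n \<in> S" and adj: "lattice_adj x n" using n nb by (auto simp: nbrs_def)
  note cl = cluster_insert_noncut[OF x nb conn]
  \<comment> \<open>The new point shares the cluster of its neighbour \<open>n\<close>, so the
    points of \<open>S\<close> still represent all components.\<close>
  have comps: "lattice_components ?S' = cluster ?S' ` S"
  proof -
    have "n \<in> cluster ?S' x" using nS adj by (auto intro!: cluster_step[OF cluster_self])
    then have "cluster ?S' x = cluster ?S' n" using cluster_eq by blast
    then show ?thesis using nS by (auto simp: lattice_components_eq)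
  qed
  have inner: "C \<in> inner_components R ?S' \<longleftrightarrow> C - {x} \<in> inner_components R S"
    if C: "C \<in> lattice_components ?S'" for C
  proof -
    have "C - {x} \<in> lattice_components S"
      using C cl unfolding comps by (auto simp: lattice_components_eq)
    moreover have "C \<inter> lattice_boundary ?D = (C - {x}) \<inter> lattice_boundary ?D" using box by auto
    \<comment> \<open>If the component meets the box at \<open>x\<close>, it also meets it at the
      neighbour \<open>n\<close>, which survives the deletion.\<close>
    moreover have "C \<inter> ?D \<noteq> {} \<longleftrightarrow> (C - {x}) \<inter> ?D \<noteq> {}"
    proof (cases "x \<in> C")
      case True
      then have "n \<in> C"
        using C adj nS cluster_step[of x ?S' _ n] unfolding comps by auto
      moreover have "n \<in> ?D" using box adj by (rule adj_interior)
      moreover have "n \<noteq> x" using n by auto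
      ultimately show ?thesis by auto
    qed auto
    ultimately show ?thesis using C by (auto simp: inner_components_def)
  qed
  have "bij_betw (\<lambda>C. C - {x}) (inner_components R ?S') (inner_components R S)"
  proof (rule bij_betw_imageI)
    show "inj_on (\<lambda>C. C - {x}) (inner_components R ?S')"
    proof (rule inj_onI)
      fix C C' assume "C \<in> inner_components R ?S'" "C' \<in> inner_components R ?S'" and eq: "C - {x} = C' - {x}"
      then obtain a b where ab: "C = cluster ?S' a" "C' = cluster ?S' b" "a \<in> S" "b \<in> S"
        by (auto simp: inner_components_def comps)
      have "a \<in> C - {x}" using ab x by (auto intro: cluster_self)
      then have "a \<in> cluster ?S' b" using eq ab by auto
      then show "C = C'" using ab cluster_eq by blast
    qed
    show "(\<lambda>C. C - {x}) ` inner_components R ?S' = inner_components R S"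
    proof (intro equalityI subsetI)
      fix C assume "C \<in> (\<lambda>C. C - {x}) ` inner_components R ?S'"
      then show "C \<in> inner_components R S" using inner by (auto simp: inner_components_def)
    next
      fix C assume C: "C \<in> inner_components R S"
      then obtain a where a: "a \<in> S" "C = cluster S a"
        by (auto simp: inner_components_def lattice_components_eq)
      then have "C = cluster ?S' a - {x}" using cl by simp
      moreover have "cluster ?S' a \<in> lattice_components ?S'" using a by (simp add: comps)
      ultimately show "C \<in> (\<lambda>C. C - {x}) ` inner_components R ?S'" using inner C by blast
    qed
  qed
  then show ?thesis by (rule bij_betw_same_card)
qed

section \<open>The block around a site\<close>

definition punctured_block :: "int ^ 'd \<Rightarrow> (int ^ 'd) set" where
  "punctured_block x = {y. y \<noteq> x \<and> (\<forall>i. \<bar>y $ i - x $ i\<bar> \<le> 1)}"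

lemma nbrs_subset_punctured_block: "nbrs x \<subseteq> punctured_block x"
proof
  fix y assume y: "y \<in> nbrs x"
  then obtain i s where "y = x + axis i s" "s \<in> {1, -1}" unfolding nbrs_eq_image by auto
  then show "y \<in> punctured_block x"
    using y not_mem_nbrs_self by (auto simp: punctured_block_def axis_def)
qed

text \<open>Neighbours in different directions have the diagonal point
  \<open>x + axis i s + axis j t\<close> in common. Neighbours on the same axis are joined by a
  detour through a second direction, whence the bound on the dimension.\<close>

lemma nbrs_joined_in_punctured_block:
  fixes x :: "int ^ 'd"
  assumes d: "CARD('d) \<ge> 2" and u: "u \<in> nbrs x" and v: "v \<in> nbrs x"
  shows "(u, v) \<in> joined_in (punctured_block x)"
proof -
  note sub = subsetD[OF nbrs_subset_punctured_block]
  have diff: "(x + axis i s, x + axis j t) \<in> joined_in (punctured_block x)"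
    if "i \<noteq> j" "s \<in> {1, -1}" "t \<in> {1, -1}" for i j s t
  proof -
    let ?m = "x + axis i s + axis j t"
    have "?m $ i = x $ i + s" using that by (simp add: axis_def)
    then have "?m $ i \<noteq> x $ i" using that by auto
    then have "?m \<noteq> x" by metis
    moreover have "\<bar>?m $ k - x $ k\<bar> \<le> 1" for k using that by (auto simp: axis_def)
    ultimately have m: "?m \<in> punctured_block x" by (simp add: punctured_block_def)
    have "x + axis i s \<in> nbrs x" "x + axis j t \<in> nbrs x"
      using that unfolding nbrs_eq_image by (force, force)
    then have ends: "x + axis i s \<in> punctured_block x" "x + axis j t \<in> punctured_block x"
      by (simp_all add: sub)
    have "lattice_adj (x + axis i s) ?m" "lattice_adj (x + axis j t) ?m"
      using that by (auto simp: lattice_adj_iff_axis algebra_simps)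
    then have "(x + axis i s, ?m) \<in> joined_in (punctured_block x)"
      "(x + axis j t, ?m) \<in> joined_in (punctured_block x)"
      using m ends by (auto intro: joined_in_step)
    then show ?thesis by (blast intro: joined_in_trans joined_in_sym)
  qed
  obtain i s where us: "u = x + axis i s" "s \<in> {1, -1}" using u unfolding nbrs_eq_image by auto
  obtain j t where vt: "v = x + axis j t" "t \<in> {1, -1}" using v unfolding nbrs_eq_image by auto
  obtain k where k: "k \<noteq> i"
  proof -
    have "UNIV \<noteq> {i}" using d by (metis card_1_singleton_iff One_nat_def Suc_1 not_less_eq_eq order_refl)
    then show thesis using that by blast
  qed
  show ?thesis
  proof (cases "i = j")
    case True
    have "(u, x + axis k 1) \<in> joined_in (punctured_block x)" unfolding us(1) using k us by (intro diff) auto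
    moreover have "(x + axis k 1, v) \<in> joined_in (punctured_block x)" unfolding vt(1) using k vt True by (intro diff) auto
    ultimately show ?thesis by (rule joined_in_trans)
  next
    case False
    then show ?thesis unfolding us(1) vt(1) using us vt by (intro diff) auto
  qed
qed

text \<open>The reference configuration has a fixed value below the level at \<open>x\<close>, so
  its count does not depend on \<open>h x\<close>. In the upper set \<open>x\<close> is an isolated
  point; in the lower set of the reference it is a point whose removal disconnects nothing.\<close>

lemma N_total_raise:
  fixes x :: "int ^ 'd"
  assumes d: "CARD('d) \<ge> 2" and box: "x \<in> lattice_box R" "x \<notin> lattice_boundary (lattice_box R)"
    and low: "\<And>y. y \<in> punctured_block x \<Longrightarrow> h y < l" and hx: "h x > l"
  shows "N_total R l h = N_total R l (h(x := l - 1)) + 1"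
proof -
  have nb: "h y < l" if "y \<in> nbrs x" for y using that low nbrs_subset_punctured_block by blast
  have "{y. h y > l} = insert x {y. (h(x := l - 1)) y > l}" using hx by auto
  then have "N_plus R l h = N_plus R l (h(x := l - 1)) + 1"
    unfolding N_plus_def
    by (simp only:) (rule card_inner_components_insert_isolated; use box nb in force)
  moreover have "{y. (h(x := l - 1)) y < l} = insert x {y. h y < l}" using hx by auto
  then have "N_minus R l (h(x := l - 1)) = N_minus R l h"
    unfolding N_minus_def
  proof (simp only:, intro card_inner_components_insert_noncut box)
    fix u v assume "u \<in> nbrs x" "v \<in> nbrs x"
    then have "(u, v) \<in> joined_in (punctured_block x)" by (rule nbrs_joined_in_punctured_block[OF d])
    moreover have "punctured_block x \<subseteq> {y. h y < l}" using low by blast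
    ultimately show "(u, v) \<in> joined_in {y. h y < l}" using joined_in_mono by blast
  qed (use hx nb in auto)
  ultimately show ?thesis by (simp add: N_total_def)
qed

lemma N_total_lower:
  assumes "h x < l"
  shows "N_total R l (h(x := l - 1)) = N_total R l h"
proof -
  have "{y. (h(x := l - 1)) y > l} = {y. h y > l}" "{y. (h(x := l - 1)) y < l} = {y. h y < l}"
    using assms by auto
  then show ?thesis by (simp add: N_total_def N_plus_def N_minus_def)
qed

section \<open>The variance bound\<close>

lemma (in prob_space) integrable_bounded:
  fixes F :: "'a \<Rightarrow> real"
  assumes "F \<in> borel_measurable M" "\<And>w. \<bar>F w\<bar> \<le> B"
  shows "integrable M F"
  using assms by (intro integrable_const_bound[where B = B]) auto

text \<open>Bessel's inequality, from expanding \<open>E (N - E N - a \<Sum>x. Y x)\<^sup>2 \<ge> 0\<close>.\<close>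

lemma (in prob_space) variance_ge_orthogonal:
  fixes N :: "'a \<Rightarrow> real" and Y :: "'x \<Rightarrow> 'a \<Rightarrow> real"
  assumes fin: "finite X"
    and N: "N \<in> borel_measurable M" "\<And>w. \<bar>N w\<bar> \<le> B"
    and Y: "\<And>x. x \<in> X \<Longrightarrow> Y x \<in> borel_measurable M" "\<And>x w. x \<in> X \<Longrightarrow> \<bar>Y x w\<bar> \<le> 1"
    and mean: "\<And>x. x \<in> X \<Longrightarrow> expectation (Y x) = 0"
    and orth: "\<And>x y. x \<in> X \<Longrightarrow> y \<in> X \<Longrightarrow> x \<noteq> y \<Longrightarrow> expectation (\<lambda>w. Y x w * Y y w) = 0"
    and corr: "\<And>x. x \<in> X \<Longrightarrow> a \<le> expectation (\<lambda>w. N w * Y x w)"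
    and a: "0 \<le> a"
  shows "a\<^sup>2 * card X \<le> variance N"
proof -
  define \<mu> where "\<mu> = expectation N"
  define T where "T w = (\<Sum>x\<in>X. Y x w)" for w
  have [measurable]: "N \<in> borel_measurable M" by fact
  have [measurable]: "T \<in> borel_measurable M" unfolding T_def using Y by simp
  have Tb: "\<bar>T w\<bar> \<le> card X" for w
    unfolding T_def using Y sum_bounded_above[of X "\<lambda>x. \<bar>Y x w\<bar>" 1] by (intro order_trans[OF sum_abs]) auto
  have iYY: "integrable M (\<lambda>w. Y x w * Y y w)" if "x \<in> X" "y \<in> X" for x y
    using that Y by (intro integrable_bounded[where B = 1]) (auto simp: abs_mult intro!: mult_le_one)
  have iNY: "integrable M (\<lambda>w. N w * Y x w)" if "x \<in> X" for x
  proof (rule integrable_bounded[where B = B])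
    fix w show "\<bar>N w * Y x w\<bar> \<le> B"
      using mult_mono[OF N(2)[of w] Y(2)[OF that, of w]] N(2)[of w] by (auto simp: abs_mult)
  qed (use Y that in simp)
  have iY: "integrable M (Y x)" if "x \<in> X" for x
    using that Y by (intro integrable_bounded[where B = 1]) auto
  have iN: "integrable M N" using N by (intro integrable_bounded[where B = B])
  have iN2: "integrable M (\<lambda>w. (N w - \<mu>)\<^sup>2)"
  proof (rule integrable_bounded[where B = "(B + \<bar>\<mu>\<bar>)\<^sup>2"])
    fix w
    have "\<bar>N w - \<mu>\<bar> \<le> B + \<bar>\<mu>\<bar>" using N(2)[of w] by linarith
    then have "\<bar>N w - \<mu>\<bar>\<^sup>2 \<le> (B + \<bar>\<mu>\<bar>)\<^sup>2" by (intro power_mono) auto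
    then show "\<bar>(N w - \<mu>)\<^sup>2\<bar> \<le> (B + \<bar>\<mu>\<bar>)\<^sup>2" by simp
  qed simp
  have iNT: "integrable M (\<lambda>w. N w * T w)"
    unfolding T_def sum_distrib_left by (intro Bochner_Integration.integrable_sum iNY)
  have iT: "integrable M T" unfolding T_def by (intro Bochner_Integration.integrable_sum iY)
  have iTT: "integrable M (\<lambda>w. T w * T w)"
    unfolding T_def sum_product by (intro Bochner_Integration.integrable_sum iYY)
  have ET: "expectation T = 0"
    unfolding T_def using iY mean by (simp add: Bochner_Integration.integral_sum)
  have "a * card X = (\<Sum>x\<in>X. a)" by simp
  also have "\<dots> \<le> (\<Sum>x\<in>X. expectation (\<lambda>w. N w * Y x w))" by (intro sum_mono corr)
  also have "\<dots> = expectation (\<lambda>w. N w * T w)"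
    unfolding T_def sum_distrib_left using iNY by (simp add: Bochner_Integration.integral_sum)
  finally have ENT: "a * card X \<le> expectation (\<lambda>w. N w * T w)" .
  have "expectation (\<lambda>w. T w * T w) = (\<Sum>x\<in>X. \<Sum>y\<in>X. expectation (\<lambda>w. Y x w * Y y w))"
    unfolding T_def sum_product using iYY by (simp add: Bochner_Integration.integral_sum)
  also have "\<dots> = (\<Sum>x\<in>X. \<Sum>y\<in>X. if y = x then expectation (\<lambda>w. Y x w * Y x w) else 0)"
    by (intro sum.cong refl) (use orth in auto)
  also have "\<dots> = (\<Sum>x\<in>X. expectation (\<lambda>w. Y x w * Y x w))" using fin by simp
  also have "\<dots> \<le> (\<Sum>x\<in>X. 1)"
  proof (intro sum_mono)
    fix x assume x: "x \<in> X"
    have "Y x w * Y x w \<le> 1" for w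
      using Y(2)[OF x, of w] abs_square_le_1[of "Y x w"] by (simp add: power2_eq_square)
    then have "expectation (\<lambda>w. Y x w * Y x w) \<le> expectation (\<lambda>w. 1)"
      using iYY[OF x x] by (intro integral_mono) auto
    then show "expectation (\<lambda>w. Y x w * Y x w) \<le> 1" by (simp add: prob_space)
  qed
  finally have ETT: "expectation (\<lambda>w. T w * T w) \<le> card X" by simp
  \<comment> \<open>With a coefficient s in place of \<open>a\<close>, the two estimates would bound
    the variance below by (2 s a - s^2) times \<open>card X\<close>, which is largest at s =
    a.\<close>
  have "0 \<le> expectation (\<lambda>w. (N w - \<mu> - a * T w)\<^sup>2)" by (intro integral_nonneg_AE) auto
  also have "\<dots> = expectation (\<lambda>w. (N w - \<mu>)\<^sup>2 - 2 * a * (N w * T w) + 2 * a * \<mu> * T w + a\<^sup>2 * (T w * T w))"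
    by (intro Bochner_Integration.integral_cong refl) (simp add: power2_eq_square algebra_simps)
  also have "\<dots> = variance N - 2 * a * expectation (\<lambda>w. N w * T w) + a\<^sup>2 * expectation (\<lambda>w. T w * T w)"
    using iN2 iNT iT iTT ET by (simp add: \<mu>_def)
  also have "\<dots> \<le> variance N - 2 * a * (a * card X) + a\<^sup>2 * card X"
    using a ENT ETT by (intro add_mono diff_mono mult_left_mono) auto
  finally show ?thesis by (simp add: power2_eq_square)
qed

section \<open>Measurability and size of the counts\<close>

lemma borel_measurable_finite_pattern:
  fixes \<phi> :: "'i set \<Rightarrow> real"
  assumes fin: "finite B" and meas: "\<And>y. y \<in> B \<Longrightarrow> {w \<in> space N. P y w} \<in> sets N"
  shows "(\<lambda>w. \<phi> {y \<in> B. P y w}) \<in> borel_measurable N"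
proof -
  \<comment> \<open>The pattern takes finitely many values, so its fibres suffice and
    \<open>\<phi>\<close> can be arbitrary.\<close>
  have "(\<lambda>w. {y \<in> B. P y w}) \<in> measurable N (count_space (Pow B))"
  proof (subst measurable_count_space_eq_countable)
    show "countable (Pow B)" using fin by (intro countable_finite) simp
    have "(\<lambda>w. {y \<in> B. P y w}) -` {A} \<inter> space N \<in> sets N" if "A \<in> Pow B" for A
    proof -
      have "(\<lambda>w. {y \<in> B. P y w}) -` {A} \<inter> space N = {w \<in> space N. \<forall>y\<in>B. y \<in> A \<longleftrightarrow> P y w}"
        using that by auto
      also have "\<dots> \<in> sets N"
      proof (intro sets.sets_Collect_finite_All fin)
        fix y assume y: "y \<in> B"
        have "{w \<in> space N. \<not> P y w} \<in> sets N" using meas[OF y] by (rule sets.sets_Collect_neg)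
        then show "{w \<in> space N. y \<in> A \<longleftrightarrow> P y w} \<in> sets N"
          using meas[OF y] by (cases "y \<in> A") auto
      qed
      finally show ?thesis .
    qed
    then show "(\<lambda>w. {y \<in> B. P y w}) \<in> space N \<rightarrow> Pow B \<and>
      (\<forall>A\<in>Pow B. (\<lambda>w. {y \<in> B. P y w}) -` {A} \<inter> space N \<in> sets N)" by auto
  qed
  then show ?thesis by (rule measurable_compose) simp
qed

lemma borel_measurable_N_total:
  assumes h: "\<And>y. y \<in> lattice_box R \<Longrightarrow> (\<lambda>w. h w y) \<in> borel_measurable N"
  shows "(\<lambda>w. real (N_total R l (h w))) \<in> borel_measurable N"
proof -
  have "{w \<in> space N. h w y > l} \<in> sets N" "{w \<in> space N. h w y < l} \<in> sets N"
    if "y \<in> lattice_box R" for y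
  proof -
    have [measurable]: "(\<lambda>w. h w y) \<in> borel_measurable N" using h that .
    show "{w \<in> space N. h w y > l} \<in> sets N" "{w \<in> space N. h w y < l} \<in> sets N" by measurable
  qed
  then show ?thesis
    unfolding N_total_local of_nat_add
    by (intro borel_measurable_add borel_measurable_finite_pattern[where \<phi> = "\<lambda>S. real (card (inner_components R S))"])
       auto
qed

text \<open>A crude bound, exponential in the volume, used for integrability; it leaves no trace in
  the final constant.\<close>

lemma N_total_le:
  "N_total R l (h :: int ^ 'd \<Rightarrow> real) \<le> 2 * card (Pow (lattice_box R :: (int ^ 'd) set))"
  unfolding N_total_local mult_2 by (intro add_mono card_inner_components_le)

section \<open>Gaussian tails\<close>

lemma std_normal_pos:
  assumes "A \<in> sets borel" "emeasure lborel A \<noteq> 0"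
  shows "measure std_normal_distribution A > 0"
proof -
  interpret real_distribution std_normal_distribution by (rule real_dist_normal_dist)
  have pos: "std_normal_density x > 0" for x using normal_density_pos[of 1 0 x] by simp
  have "A \<notin> null_sets std_normal_distribution"
  proof
    assume "A \<in> null_sets std_normal_distribution"
    then have "AE x in lborel. x \<in> A \<longrightarrow> ennreal (std_normal_density x) = 0"
      by (subst (asm) null_sets_density_iff) auto
    then have "AE x in lborel. x \<notin> A"
      by eventually_elim (use pos in \<open>auto simp: ennreal_eq_0_iff not_le[symmetric]\<close>)
    then have "A \<in> null_sets lborel" using assms(1) by (simp add: AE_iff_null_sets)
    then show False using assms(2) by auto
  qed
  then have "emeasure std_normal_distribution A \<noteq> 0" using assms(1) by (auto simp: null_sets_def)
  then show ?thesis by (simp add: emeasure_eq_measure less_le)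
qed

lemma std_normal_Ioi_pos: "measure std_normal_distribution {K<..} > 0"
proof (rule std_normal_pos)
  have "emeasure lborel {K<..<K+1} \<le> emeasure lborel {K<..}" by (intro emeasure_mono) auto
  then show "emeasure lborel {K<..} \<noteq> 0" by auto
qed simp

lemma std_normal_Iio_pos: "measure std_normal_distribution {..<K} > 0"
proof (rule std_normal_pos)
  have "emeasure lborel {K-1<..<K} \<le> emeasure lborel {..<K}" by (intro emeasure_mono) auto
  then show "emeasure lborel {..<K} \<noteq> 0" by auto
qed simp

section \<open>Blocks and the even sublattice\<close>

lemma bij_betw_punctured_block:
  fixes x :: "int ^ 'd"
  shows "bij_betw (\<lambda>y. y - x) (punctured_block x) (punctured_block 0)"
  by (rule bij_betwI[where g = "\<lambda>y. y + x"]) (auto simp: punctured_block_def)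

lemma card_punctured_block:
  fixes x :: "int ^ 'd"
  shows "card (punctured_block x) = card (punctured_block (0 :: int ^ 'd))"
  by (rule bij_betw_same_card[OF bij_betw_punctured_block])

lemma finite_punctured_block [simp]: "finite (punctured_block (x :: int ^ 'd))"
proof -
  have "punctured_block (0 :: int ^ 'd) \<subseteq> {y. \<forall>i. y $ i \<in> {-1..1}}"
    by (auto simp: punctured_block_def abs_le_iff)
  then have "finite (punctured_block (0 :: int ^ 'd))"
    by (rule finite_subset) (rule finite_vec_box, simp)
  then show ?thesis using bij_betw_finite[OF bij_betw_punctured_block] by blast
qed

lemma not_mem_punctured_block_self [simp]: "x \<notin> punctured_block x"
  by (simp add: punctured_block_def)

text \<open>Points with even coordinates of modulus at most R - 1; the margin of one keeps all
  neighbours inside the box.\<close>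

definition sites :: "real \<Rightarrow> (int ^ 'd) set" where
  "sites R = {x. \<forall>i. x $ i \<in> (\<lambda>k. 2 * k) ` {- \<lfloor>(R - 1) / 2\<rfloor>..\<lfloor>(R - 1) / 2\<rfloor>}}"

lemma finite_sites [simp]: "finite (sites R)"
  unfolding sites_def by (rule finite_vec_box) simp

lemma card_sites:
  assumes "R \<ge> 1"
  shows "(R / 3) ^ CARD('d) \<le> card (sites R :: (int ^ 'd) set)"
proof -
  define m where "m = \<lfloor>(R - 1) / 2\<rfloor>"
  have m: "m \<ge> 0" using assms by (simp add: m_def)
  have "(R - 1) / 2 - 1 < real_of_int m" unfolding m_def by (rule real_of_int_floor_gt_diff_one)
  then have "R < 2 * real_of_int m + 3" by (simp add: field_simps)
  \<comment> \<open>R < 2m + 3 \<le> 3 (2m + 1) because m \<ge> 0. The divisor 3 is dictated by m =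
    0, where R may come close to 3.\<close>
  then have "R / 3 \<le> 2 * real_of_int m + 1" using m by (simp add: field_simps)
  then have "(R / 3) ^ CARD('d) \<le> (2 * real_of_int m + 1) ^ CARD('d)"
    using assms by (intro power_mono) auto
  also have "card ((\<lambda>k. 2 * k) ` {- m..m}) = nat (2 * m + 1)"
    by (subst card_image) (auto simp: inj_on_def)
  then have "(2 * real_of_int m + 1) ^ CARD('d) = card (sites R :: (int ^ 'd) set)"
    using m unfolding sites_def card_vec_box m_def[symmetric] by simp
  finally show ?thesis by simp
qed

lemma sites_interior:
  assumes "x \<in> sites R"
  shows "x \<in> lattice_box R" "x \<notin> lattice_boundary (lattice_box R)"
proof -
  have b: "\<bar>real_of_int (x $ i)\<bar> \<le> R - 1" for i
  proof -
    obtain k where "x $ i = 2 * k" "- \<lfloor>(R - 1) / 2\<rfloor> \<le> k" "k \<le> \<lfloor>(R - 1) / 2\<rfloor>"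
    proof -
      have "x $ i \<in> (\<lambda>k. 2 * k) ` {- \<lfloor>(R - 1) / 2\<rfloor>..\<lfloor>(R - 1) / 2\<rfloor>}"
        using assms by (simp add: sites_def)
      then show thesis using that by auto
    qed
    then show ?thesis using floor_correct[of "(R - 1) / 2"] by (simp add: abs_le_iff)
  qed
  have "- R \<le> real_of_int (x $ i) \<and> real_of_int (x $ i) \<le> R" for i using b[of i] by linarith
  then show "x \<in> lattice_box R" by (simp add: lattice_box_def)
  have "y \<in> lattice_box R" if "lattice_adj x y" for y
  proof -
    have "y \<in> punctured_block x" using that nbrs_subset_punctured_block by (auto simp: nbrs_def)
    then have "\<bar>y $ i - x $ i\<bar> \<le> 1" for i by (simp add: punctured_block_def)
    then have "\<bar>real_of_int (y $ i) - real_of_int (x $ i)\<bar> \<le> 1" for i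
      by (metis of_int_abs of_int_diff of_int_le_1_iff)
    then have "- R \<le> real_of_int (y $ i) \<and> real_of_int (y $ i) \<le> R" for i
      using b[of i] by (smt (verit))
    then show ?thesis by (simp add: lattice_box_def)
  qed
  then show "x \<notin> lattice_boundary (lattice_box R)" by (auto simp: lattice_boundary_def)
qed

text \<open>Even coordinates that differ by at most one are equal. The blocks of two sites may still
  overlap; only their centres have to be avoided.\<close>

lemma sites_separated:
  assumes "x \<in> sites R" "y \<in> sites R" "x \<noteq> y"
  shows "x \<notin> punctured_block y"
proof
  assume x: "x \<in> punctured_block y"
  have "x $ i = y $ i" for i
  proof -
    have "x $ i \<in> range (\<lambda>k. 2 * k)" "y $ i \<in> range (\<lambda>k. 2 * k)"
      using assms(1,2) by (auto simp: sites_def image_iff)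
    then obtain k k' where "x $ i = 2 * k" "y $ i = 2 * k'" by blast
    moreover have "\<bar>x $ i - y $ i\<bar> \<le> 1" using x by (simp add: punctured_block_def)
    ultimately show ?thesis by presburger
  qed
  then show False using assms by (simp add: vec_eq_iff)
qed

section \<open>Innovations of the free field\<close>

locale lattice_gff = centered_gaussian_field M f
  for M :: "'w measure" and f :: "int ^ 'd \<Rightarrow> 'w \<Rightarrow> real" +
  assumes dim: "CARD('d) \<ge> 3"
    and covariance: "\<And>x y. expectation (\<lambda>w. f x w * f y w) = green (x - y)"
begin

definition nbr_avg :: "int ^ 'd \<Rightarrow> 'w \<Rightarrow> real" where
  "nbr_avg x w = (\<Sum>z\<in>nbrs x. f z w) / (2 * CARD('d))"

text \<open>The average involves other sites only, and the difference turns out to be independent of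
  all of them: it is \<open>f x\<close> minus its conditional expectation given the rest of the
  field.\<close>

definition innov :: "int ^ 'd \<Rightarrow> 'w \<Rightarrow> real" where
  "innov x w = f x w - nbr_avg x w"

lemma nbr_avg_lin_span: "nbr_avg x \<in> lin_span"
  using lin_span_sum[of "nbrs x" "\<lambda>_. 1 / (2 * CARD('d))"]
  by (simp add: nbr_avg_def[abs_def] sum_divide_distrib)

lemma innov_lin_span: "innov x \<in> lin_span"
  using lin_span_add[OF lin_span_single lin_span_scale[OF nbr_avg_lin_span], of x "-1" x]
  by (simp add: innov_def[abs_def])

lemma measurable_innov [measurable]: "innov x \<in> borel_measurable M"
  by (rule measurable_lin_span[OF innov_lin_span])

lemma measurable_nbr_avg [measurable]: "nbr_avg x \<in> borel_measurable M"
  by (rule measurable_lin_span[OF nbr_avg_lin_span])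

lemma integrable_field_mult: "integrable M (\<lambda>w. f x w * f y w)"
  by (intro integrable_mult_lin_span lin_span_single)

text \<open>By bilinearity this covariance is the discrete Laplacian of the Green's function at
  \<open>x - y\<close>, a point mass.\<close>

lemma innov_field: "expectation (\<lambda>w. innov x w * f y w) = (if x = y then 1 else 0)"
proof -
  have "expectation (\<lambda>w. innov x w * f y w)
      = expectation (\<lambda>w. f x w * f y w - (\<Sum>z\<in>nbrs x. f z w * f y w) / (2 * CARD('d)))"
    by (intro Bochner_Integration.integral_cong refl)
       (simp add: innov_def nbr_avg_def left_diff_distrib sum_distrib_right)
  also have "\<dots> = green (x - y) - (\<Sum>z\<in>nbrs x. green (z - y)) / (2 * CARD('d))"
    using integrable_field_mult by (simp add: covariance)
  also have "(\<Sum>z\<in>nbrs x. green (z - y)) = (\<Sum>z\<in>nbrs (x - y). green z)"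
    unfolding nbrs_diff by (subst sum.reindex) (auto simp: inj_on_def)
  finally show ?thesis using green_equation[OF dim, of "x - y"] by simp
qed

lemma innov_variance: "expectation (\<lambda>w. (innov x w)\<^sup>2) = 1"
proof -
  have i: "integrable M (\<lambda>w. innov x w * f z w)" for z
    by (intro integrable_mult_lin_span lin_span_single innov_lin_span)
  have "expectation (\<lambda>w. (innov x w)\<^sup>2)
      = expectation (\<lambda>w. innov x w * f x w - (\<Sum>z\<in>nbrs x. innov x w * f z w) / (2 * CARD('d)))"
    by (intro Bochner_Integration.integral_cong refl)
       (simp add: innov_def nbr_avg_def power2_eq_square right_diff_distrib sum_distrib_left)
  also have "\<dots> = 1 - (\<Sum>z\<in>nbrs x. if x = z then 1 else 0) / (2 * CARD('d))"
    using i by (simp add: innov_field)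
  also have "(\<Sum>z\<in>nbrs x. if x = z then 1 else 0) = (0 :: real)" by (intro sum.neutral) auto
  finally show ?thesis by simp
qed

lemma innov_distributed: "distributed M lborel (innov x) std_normal_density"
  using gaussian_lin_span[OF innov_lin_span] lin_span_centered[OF innov_lin_span, of x]
proof (cases rule: centered_gaussian_rv_cases)
  case (normal \<sigma>)
  then have "\<sigma>\<^sup>2 = 1"
    using normal_distributed_variance[OF normal] innov_variance lin_span_centered[OF innov_lin_span, of x] by simp
  then have "\<sigma> = 1" using normal(1) by (simp add: power2_eq_1_iff)
  then show ?thesis using normal by simp
next
  case zero
  then have "expectation (\<lambda>w. (innov x w)\<^sup>2) = expectation (\<lambda>w. 0)"
    by (intro integral_cong_AE) auto
  then show ?thesis using innov_variance[of x] by simp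
qed

lemma prob_innov:
  assumes [measurable]: "C \<in> sets borel"
  shows "prob {w \<in> space M. innov x w \<in> C} = measure std_normal_distribution C"
proof -
  have "std_normal_distribution = distr M lborel (innov x)"
    by (rule distributed_distr_eq_density[OF innov_distributed, symmetric])
  then show ?thesis by (simp add: measure_distr vimage_def Int_def conj_commute)
qed

text \<open>All information except the value at \<open>x\<close>. It determines
  \<open>nbr_avg x\<close>, so given it \<open>f x\<close> is a known shift of independent
  noise.\<close>

abbreviation off :: "int ^ 'd \<Rightarrow> 'w measure" where
  "off x \<equiv> cyl_algebra M f (- {x})"

lemma space_off: "space (off x) = space M"
  by (rule space_measure_of_conv)

lemma measurable_off: "y \<noteq> x \<Longrightarrow> f y \<in> borel_measurable (off x)"
  by (rule measurable_cyl_algebra) simp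

lemma measurable_nbr_avg_off: "x \<notin> nbrs y \<Longrightarrow> nbr_avg y \<in> borel_measurable (off x)"
  unfolding nbr_avg_def[abs_def]
  by (intro borel_measurable_divide borel_measurable_sum measurable_off) auto

lemma innov_indep: "indep_set {innov x -` B \<inter> space M | B. B \<in> sets borel} (cylinders M f (- {x}))"
  by (rule indep_set_lin_span[OF innov_lin_span]) (simp add: innov_field)

lemma sets_off_events: "sets (off x) \<subseteq> events"
  using indep_setD_ev2[OF innov_indep[of x]] by (simp add: cylinders_subset sets.sigma_sets_subset)

lemma measurable_off_imp:
  fixes W :: "'w \<Rightarrow> real"
  shows "W \<in> borel_measurable (off x) \<Longrightarrow> W \<in> borel_measurable M"
proof (rule measurableI)
  fix A :: "real set"
  assume "W \<in> borel_measurable (off x)" "A \<in> sets borel"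
  then have "W -` A \<inter> space (off x) \<in> sets (off x)" by (rule measurable_sets)
  then show "W -` A \<inter> space M \<in> events" using sets_off_events unfolding space_off by blast
qed simp

lemma expectation_mult_innov:
  fixes W :: "'w \<Rightarrow> real"
  assumes W: "W \<in> borel_measurable (off x)" "\<And>w. \<bar>W w\<bar> \<le> B"
    and g: "g \<in> borel_measurable borel" "\<And>t. \<bar>g t\<bar> \<le> B'"
  shows "expectation (\<lambda>w. W w * g (innov x w)) = expectation W * expectation (\<lambda>w. g (innov x w))"
proof (rule expectation_mult_cyl_algebra[OF innov_indep measurable_innov W(1) _ g(1)])
  show "integrable M W" using measurable_off_imp[OF W(1)] W(2) by (rule integrable_bounded)
  show "integrable M (\<lambda>w. g (innov x w))" using g by (intro integrable_bounded[where B = B']) auto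
qed

lemma prob_inter_innov:
  assumes A: "A \<in> sets (off x)" and C: "C \<in> sets borel"
  shows "prob (A \<inter> {w \<in> space M. innov x w \<in> C}) = prob A * measure std_normal_distribution C"
proof -
  have [measurable]: "A \<in> events" "C \<in> sets borel" using A C sets_off_events by auto
  have "prob (A \<inter> {w \<in> space M. innov x w \<in> C}) = expectation (indicator (A \<inter> {w \<in> space M. innov x w \<in> C}))"
    by simp
  also have "\<dots> = expectation (\<lambda>w. indicator A w * indicator C (innov x w))"
    by (intro Bochner_Integration.integral_cong refl) (auto simp: indicator_def)
  also have "\<dots> = expectation (indicator A) * expectation (\<lambda>w. indicator C (innov x w))"
    using A C by (intro expectation_mult_innov[where B = 1 and B' = 1]) (auto simp: indicator_def)
  also have "expectation (\<lambda>w. indicator C (innov x w)) = expectation (indicator {w \<in> space M. innov x w \<in> C})"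
    by (intro Bochner_Integration.integral_cong refl) (auto simp: indicator_def)
  finally show ?thesis by (simp add: prob_innov)
qed

section \<open>Uniform lower bounds by resampling\<close>

lemma green_0_nonneg: "0 \<le> green (0 :: int ^ 'd)"
  using covariance[of 0 0] integral_nonneg_AE[of "\<lambda>w. f 0 w * f 0 w" M] by simp

text \<open>Chebyshev's inequality for \<open>nbr_avg x\<close> written as \<open>f x\<close> minus
  \<open>innov x\<close>. The second moments of both are the same at every site, so the bound is
  uniform in \<open>x\<close>.\<close>

lemma nbr_avg_tail:
  assumes "0 < t"
  shows "prob {w \<in> space M. t \<le> \<bar>nbr_avg x w\<bar>} \<le> (2 * green (0 :: int ^ 'd) + 2) / t\<^sup>2"
proof -
  have i: "integrable M (\<lambda>w. (nbr_avg x w)\<^sup>2)" "integrable M (\<lambda>w. (innov x w)\<^sup>2)" "integrable M (\<lambda>w. (f x w)\<^sup>2)"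
    by (intro integrable_square_lin_span nbr_avg_lin_span innov_lin_span lin_span_single)+
  have "(nbr_avg x w)\<^sup>2 \<le> 2 * (f x w)\<^sup>2 + 2 * (innov x w)\<^sup>2" for w
    using sum_squares_bound[of "f x w" "- innov x w"] unfolding innov_def
    by (simp add: power2_eq_square algebra_simps)
  then have "expectation (\<lambda>w. (nbr_avg x w)\<^sup>2) \<le> expectation (\<lambda>w. 2 * (f x w)\<^sup>2 + 2 * (innov x w)\<^sup>2)"
    using i by (intro integral_mono) auto
  also have "\<dots> = 2 * green (0 :: int ^ 'd) + 2"
    using i covariance[of x x] innov_variance[of x] by (simp add: power2_eq_square)
  finally have b: "expectation (\<lambda>w. (nbr_avg x w)\<^sup>2) \<le> 2 * green (0 :: int ^ 'd) + 2" .
  have "{w \<in> space M. t \<le> \<bar>nbr_avg x w\<bar>} = {w \<in> space M. t\<^sup>2 \<le> (nbr_avg x w)\<^sup>2}"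
    using assms by (auto simp: abs_le_square_iff[symmetric])
  then have "prob {w \<in> space M. t \<le> \<bar>nbr_avg x w\<bar>} \<le> expectation (\<lambda>w. (nbr_avg x w)\<^sup>2) / t\<^sup>2"
    using integral_Markov_inequality_measure[OF i(1), of "{}" "t\<^sup>2"] assms by simp
  also have "\<dots> \<le> (2 * green (0 :: int ^ 'd) + 2) / t\<^sup>2" using b by (intro divide_right_mono) auto
  finally show ?thesis .
qed

text \<open>The threshold is where Chebyshev's bound falls to \<open>c / 2\<close>, so cutting off
  the tail costs at most half of the probability, however \<open>A\<close> and
  \<open>nbr_avg x\<close> depend on each other.\<close>

lemma prob_inter_nbr_avg:
  assumes A: "A \<in> events" and c: "c > 0" "c \<le> prob A"
    and t: "t \<ge> sqrt (2 * (2 * green (0 :: int ^ 'd) + 2) / c)"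
  shows "c / 2 \<le> prob (A \<inter> {w \<in> space M. \<bar>nbr_avg x w\<bar> < t})"
proof -
  let ?B = "2 * green (0 :: int ^ 'd) + 2"
  have B: "?B > 0" using green_0_nonneg by linarith
  then have "0 < sqrt (2 * ?B / c)" using c by simp
  with t have t0: "t > 0" by linarith
  have "2 * ?B / c = (sqrt (2 * ?B / c))\<^sup>2" using B c by simp
  also have "\<dots> \<le> t\<^sup>2" using t B c by (intro power_mono) auto
  finally have "?B / t\<^sup>2 \<le> c / 2" using t0 c by (simp add: field_simps)
  then have "prob {w \<in> space M. t \<le> \<bar>nbr_avg x w\<bar>} \<le> c / 2" using nbr_avg_tail[OF t0, of x] by linarith
  moreover have "prob A \<le> prob (A \<inter> {w \<in> space M. \<bar>nbr_avg x w\<bar> < t}) + prob {w \<in> space M. t \<le> \<bar>nbr_avg x w\<bar>}"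
  proof -
    have "prob A \<le> prob ((A \<inter> {w \<in> space M. \<bar>nbr_avg x w\<bar> < t}) \<union> {w \<in> space M. t \<le> \<bar>nbr_avg x w\<bar>})"
      using A sets.sets_into_space[OF A] by (intro finite_measure_mono) auto
    also have "\<dots> \<le> prob (A \<inter> {w \<in> space M. \<bar>nbr_avg x w\<bar> < t}) + prob {w \<in> space M. t \<le> \<bar>nbr_avg x w\<bar>}"
      using A by (intro measure_Un_le) auto
    finally show ?thesis .
  qed
  ultimately show ?thesis using c by linarith
qed

definition below :: "real \<Rightarrow> (int ^ 'd) set \<Rightarrow> 'w set" where
  "below l S = {w \<in> space M. \<forall>y\<in>S. f y w < l}"

lemma below_off:
  assumes "finite S" "x \<notin> S"
  shows "below l S \<in> sets (off x)"
proof -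
  have "{w \<in> space (off x). f y w < l} \<in> sets (off x)" if "y \<in> S" for y
  proof -
    have [measurable]: "f y \<in> borel_measurable (off x)" using that assms by (intro measurable_off) auto
    show ?thesis by measurable
  qed
  then have "{w \<in> space (off x). \<forall>y\<in>S. f y w < l} \<in> sets (off x)"
    using assms by (intro sets.sets_Collect_finite_All) auto
  then show ?thesis unfolding below_def space_off .
qed

text \<open>Resampling \<open>innov x\<close> at a new site \<open>x\<close>: by Markov's inequality \<open>nbr_avg x\<close> is bounded on half of the
  event obtained so far. The bound is uniform in \<open>S\<close> because only \<open>green 0\<close> enters.\<close>

lemma prob_below_lower_bound:
  "\<exists>c>0. \<forall>S. finite S \<and> card S = n \<longrightarrow> c \<le> prob (below l S)"
proof (induction n)
  case 0
  then show ?case by (intro exI[of _ 1]) (auto simp: below_def prob_space)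
next
  case (Suc n)
  then obtain c where c: "c > 0" "\<And>S. finite S \<Longrightarrow> card S = n \<Longrightarrow> c \<le> prob (below l S)" by blast
  define t where "t = sqrt (2 * (2 * green (0 :: int ^ 'd) + 2) / c)"
  \<comment> \<open>If the average is below \<open>t\<close> and the innovation below
    \<open>l - t\<close>, their sum \<open>f x\<close> is below \<open>l\<close>.\<close>
  define \<delta> where "\<delta> = measure std_normal_distribution {..<l - t}"
  have \<delta>: "\<delta> > 0" unfolding \<delta>_def by (rule std_normal_Iio_pos)
  have "c / 2 * \<delta> \<le> prob (below l S)" if S: "finite S" "card S = Suc n" for S
  proof -
    obtain x S' where xS: "S = insert x S'" "x \<notin> S'" "card S' = n"
      using S(2) by (auto simp: card_Suc_eq)
    then have fin: "finite S'" using S by simp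
    have B: "below l S' \<in> sets (off x)" using fin xS by (intro below_off)
    have Be: "below l T \<in> events" if "finite T" for T
    proof -
      have "{w \<in> space M. f y w < l} \<in> events" for y by measurable
      then show ?thesis unfolding below_def using that by (intro sets.sets_Collect_finite_All) auto
    qed
    let ?A = "below l S' \<inter> {w \<in> space M. \<bar>nbr_avg x w\<bar> < t}"
    \<comment> \<open>The set \<open>S'\<close> omits \<open>x\<close>, and the neighbour average at
      \<open>x\<close> does not involve \<open>f x\<close>; hence the innovation at \<open>x\<close>
      is independent of this event.\<close>
    have A: "?A \<in> sets (off x)"
    proof -
      have [measurable]: "nbr_avg x \<in> borel_measurable (off x)" by (rule measurable_nbr_avg_off) simp
      have "{w \<in> space (off x). \<bar>nbr_avg x w\<bar> < t} \<in> sets (off x)" by measurable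
      then show ?thesis using B unfolding space_off by (intro sets.Int)
    qed
    have "c / 2 \<le> prob ?A"
      using Be[OF fin] c xS fin by (intro prob_inter_nbr_avg) (auto simp: t_def)
    then have "c / 2 * \<delta> \<le> prob ?A * \<delta>" using \<delta> by simp
    also have "\<dots> = prob (?A \<inter> {w \<in> space M. innov x w \<in> {..<l - t}})"
      unfolding \<delta>_def using A by (intro prob_inter_innov[symmetric]) auto
    also have "\<dots> \<le> prob (below l S)"
      using Be[OF S(1)] by (intro finite_measure_mono) (auto simp: below_def xS innov_def)
    finally show ?thesis .
  qed
  then show ?case using c \<delta> by (intro exI[of _ "c / 2 * \<delta>"]) auto
qed

text \<open>On the block event the average is below \<open>l\<close> anyway, so here it lies in a
  window of length \<open>K\<close> under the level. Then \<open>innov x\<close> above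
  \<open>K\<close> forces \<open>f x\<close> above \<open>l\<close>, and \<open>innov x\<close>
  below \<open>- K\<close> forces it below: the innovation alone decides.\<close>

definition good :: "real \<Rightarrow> real \<Rightarrow> int ^ 'd \<Rightarrow> 'w set" where
  "good l K x = below l (punctured_block x) \<inter> {w \<in> space M. l - K \<le> nbr_avg x w}"

lemma good_off:
  assumes "x \<notin> punctured_block y"
  shows "good l K y \<in> sets (off x)"
proof -
  have [measurable]: "nbr_avg y \<in> borel_measurable (off x)"
    using assms nbrs_subset_punctured_block by (intro measurable_nbr_avg_off) blast
  have "{w \<in> space (off x). l - K \<le> nbr_avg y w} \<in> sets (off x)" by measurable
  then show ?thesis unfolding good_def space_off
    using assms by (intro sets.Int below_off finite_punctured_block)
qed

lemma good_events [measurable]: "good l K x \<in> events"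
  using good_off[of x x l K] sets_off_events by auto

lemma prob_good_lower_bound: "\<exists>c>0. \<exists>K\<ge>0. \<forall>x. c \<le> prob (good l K x)"
proof -
  obtain c where c: "c > 0"
    "\<And>S. finite S \<Longrightarrow> card S = card (punctured_block (0 :: int ^ 'd)) \<Longrightarrow> c \<le> prob (below l S)"
    using prob_below_lower_bound by blast
  define t where "t = sqrt (2 * (2 * green (0 :: int ^ 'd) + 2) / c)"
  have t: "t \<ge> 0" using c green_0_nonneg by (simp add: t_def)
  \<comment> \<open>The choice \<open>t + \<bar>l\<bar>\<close> for \<open>K\<close> gives
    \<open>l - K \<le> - t\<close>, so an average of modulus less than \<open>t\<close> satisfies
    the lower bound.\<close>
  have "c / 2 \<le> prob (good l (t + \<bar>l\<bar>) x)" for x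
  proof -
    have ev: "below l (punctured_block x) \<in> events"
      using below_off[of "punctured_block x" x l] sets_off_events by auto
    have "c / 2 \<le> prob (below l (punctured_block x) \<inter> {w \<in> space M. \<bar>nbr_avg x w\<bar> < t})"
      using c ev by (intro prob_inter_nbr_avg) (auto simp: t_def card_punctured_block[of x])
    also have "\<dots> \<le> prob (good l (t + \<bar>l\<bar>) x)"
      by (intro finite_measure_mono good_events) (auto simp: good_def)
    finally show ?thesis .
  qed
  then show ?thesis using c t
    by (intro exI[of _ "c / 2"] conjI exI[of _ "t + \<bar>l\<bar>"]) auto
qed

section \<open>Probes and their correlation with the count\<close>

lemma nbr_avg_less:
  assumes "\<And>z. z \<in> nbrs x \<Longrightarrow> f z w < l"
  shows "nbr_avg x w < l"
proof -
  have "(\<Sum>z\<in>nbrs x. f z w) < (\<Sum>z\<in>nbrs x. l)" using assms by (intro sum_strict_mono) auto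
  then show ?thesis by (simp add: nbr_avg_def card_nbrs field_simps)
qed

text \<open>Each tail is weighted with the mass of the other, which makes the mean vanish. Between
  \<open>- K\<close> and \<open>K\<close>, where the innovation need not decide the side of the
  level, the function is zero.\<close>

definition kick :: "real \<Rightarrow> real \<Rightarrow> real" where
  "kick K t = measure std_normal_distribution {..<- K} * indicator {K<..} t
    - measure std_normal_distribution {K<..} * indicator {..<- K} t"

lemma measurable_kick [measurable]: "kick K \<in> borel_measurable borel"
  unfolding kick_def[abs_def] by measurable

lemma abs_kick_le: "\<bar>kick K t\<bar> \<le> 1" if "K \<ge> 0"
proof -
  interpret std: real_distribution std_normal_distribution by (rule real_dist_normal_dist)
  show ?thesis using that std.prob_le_1 by (auto simp: kick_def indicator_def)
qed

lemma expectation_kick: "expectation (\<lambda>w. kick K (innov x w)) = 0"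
proof -
  have ind: "expectation (\<lambda>w. indicator C (innov x w) :: real) = measure std_normal_distribution C"
    if "C \<in> sets borel" for C
  proof -
    have [measurable]: "C \<in> sets borel" by fact
    have "expectation (\<lambda>w. indicator C (innov x w) :: real) = expectation (indicator {w \<in> space M. innov x w \<in> C})"
      by (intro Bochner_Integration.integral_cong refl) (auto simp: indicator_def)
    then show ?thesis using that by (simp add: prob_innov)
  qed
  have i: "integrable M (\<lambda>w. indicator C (innov x w) :: real)" if [measurable]: "C \<in> sets borel" for C
    by (rule integrable_bounded[where B = 1]) (auto simp: indicator_def)
  show ?thesis unfolding kick_def
    by (subst Bochner_Integration.integral_diff) (auto simp: ind i)
qed

definition probe :: "real \<Rightarrow> real \<Rightarrow> int ^ 'd \<Rightarrow> 'w \<Rightarrow> real" where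
  "probe l K x w = indicator (good l K x) w * kick K (innov x w)"

lemma measurable_probe [measurable]: "probe l K x \<in> borel_measurable M"
  unfolding probe_def[abs_def] by measurable

lemma abs_probe_le: "K \<ge> 0 \<Longrightarrow> \<bar>probe l K x w\<bar> \<le> 1"
  using abs_kick_le[of K] by (auto simp: probe_def indicator_def)

text \<open>The event \<open>good l K x\<close> is determined off \<open>x\<close>, so given the
  field there the probe is a fixed multiple of a centred variable.\<close>

lemma expectation_mult_probe:
  assumes "K \<ge> 0" and W: "W \<in> borel_measurable (off x)" "\<And>w. \<bar>W w\<bar> \<le> B"
  shows "expectation (\<lambda>w. W w * probe l K x w) = 0"
proof -
  have [measurable]: "good l K x \<in> sets (off x)" "W \<in> borel_measurable (off x)"
    using W by (auto intro: good_off)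
  have "expectation (\<lambda>w. W w * probe l K x w)
      = expectation (\<lambda>w. (W w * indicator (good l K x) w) * kick K (innov x w))"
    by (simp add: probe_def mult.assoc)
  also have "\<dots> = 0"
  proof (subst expectation_mult_innov[where B = B and B' = 1])
    show "\<bar>W w * indicator (good l K x) w\<bar> \<le> B" for w
      using W(2)[of w] by (auto simp: indicator_def)
  qed (use abs_kick_le[OF assms(1)] in \<open>auto simp: expectation_kick\<close>)
  finally show ?thesis .
qed

lemma expectation_probe: "K \<ge> 0 \<Longrightarrow> expectation (probe l K x) = 0"
  using expectation_mult_probe[of K "\<lambda>_. 1" x 1 l] by simp

text \<open>Conditioning is on the field off \<open>x\<close>: the site \<open>y\<close>, its
  neighbours and its block all avoid \<open>x\<close>, so the probe at \<open>y\<close> is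
  determined there.\<close>

lemma probe_orthogonal:
  assumes "K \<ge> 0" "x \<noteq> y" "x \<notin> punctured_block y"
  shows "expectation (\<lambda>w. probe l K x w * probe l K y w) = 0"
proof -
  have [measurable]: "f y \<in> borel_measurable (off x)" "nbr_avg y \<in> borel_measurable (off x)"
    "good l K y \<in> sets (off x)"
    using assms nbrs_subset_punctured_block by (auto intro!: measurable_off measurable_nbr_avg_off good_off)
  have "probe l K y \<in> borel_measurable (off x)"
    unfolding probe_def[abs_def] innov_def by measurable
  then have "expectation (\<lambda>w. probe l K y w * probe l K x w) = 0"
    using assms abs_probe_le by (intro expectation_mult_probe) auto
  then show ?thesis by (simp add: mult.commute)
qed

text \<open>The count is split into \<open>N'\<close>, the count after lowering the field at
  \<open>x\<close>, and a correction supported on the upper tail. The first part is determined off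
  \<open>x\<close> and is uncorrelated with the probe; the second gives the product on the
  right.\<close>

lemma count_probe_correlation:
  assumes K: "K \<ge> 0" and box: "x \<in> lattice_box R" "x \<notin> lattice_boundary (lattice_box R)"
  shows "expectation (\<lambda>w. real (N_total R l (\<lambda>y. f y w)) * probe l K x w)
    = measure std_normal_distribution {..<- K} * measure std_normal_distribution {K<..} * prob (good l K x)"
proof -
  let ?pL = "measure std_normal_distribution {..<- K}" and ?pU = "measure std_normal_distribution {K<..}"
  define N' where "N' w = real (N_total R l ((\<lambda>y. f y w)(x := l - 1)))" for w
  define B where "B = real (2 * card (Pow (lattice_box R :: (int ^ 'd) set)))"
  have N'm: "N' \<in> borel_measurable (off x)"
    unfolding N'_def[abs_def]
  proof (rule borel_measurable_N_total)
    fix y show "(\<lambda>w. ((\<lambda>y. f y w)(x := l - 1)) y) \<in> borel_measurable (off x)"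
      by (cases "y = x") (auto intro: measurable_off)
  qed
  have N'b: "\<bar>N' w\<bar> \<le> B" for w
    unfolding N'_def B_def using N_total_le[of R l] by (simp del: of_nat_mult)
  have [measurable]: "N' \<in> borel_measurable M" using N'm by (rule measurable_off_imp)
  have pointwise: "real (N_total R l (\<lambda>y. f y w)) * probe l K x w =
      N' w * probe l K x w + ?pL * indicator (good l K x \<inter> {w \<in> space M. innov x w \<in> {K<..}}) w"
    if w: "w \<in> space M" for w
  proof (cases "w \<in> good l K x")
    case True
    have low: "f y w < l" if "y \<in> punctured_block x" for y
      using True that by (auto simp: good_def below_def)
    have avg: "l - K \<le> nbr_avg x w" "nbr_avg x w < l"
      using True low nbrs_subset_punctured_block by (auto simp: good_def intro: nbr_avg_less)
    \<comment> \<open>In the upper tail the count is \<open>N' w + 1\<close>; in the lower tail,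
      where \<open>K \<ge> 0\<close> puts \<open>f x w\<close> below \<open>l\<close>, it is
      \<open>N' w\<close>; in between the probe vanishes.\<close>
    consider "innov x w > K" | "innov x w < - K" | "- K \<le> innov x w" "innov x w \<le> K" by linarith
    then show ?thesis
    proof cases
      case 1
      then have "f x w > l" using avg by (simp add: innov_def)
      then have "real (N_total R l (\<lambda>y. f y w)) = N' w + 1"
        unfolding N'_def using N_total_raise[OF _ box, of "\<lambda>y. f y w" l] low dim by simp
      moreover have "probe l K x w = ?pL" using True 1 K by (simp add: probe_def kick_def)
      ultimately show ?thesis using True 1 w by (simp add: algebra_simps)
    next
      case 2
      then have "f x w < l" using avg K by (simp add: innov_def)
      then have "real (N_total R l (\<lambda>y. f y w)) = N' w"
        unfolding N'_def using N_total_lower[of "\<lambda>y. f y w" x l R] by simp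
      then show ?thesis using 2 K by simp
    next
      case 3
      then show ?thesis by (simp add: probe_def kick_def)
    qed
  qed (simp add: probe_def)
  have i: "integrable M (\<lambda>w. N' w * probe l K x w)"
  proof (rule integrable_bounded[where B = B])
    fix w show "\<bar>N' w * probe l K x w\<bar> \<le> B"
      using mult_mono[OF N'b[of w] abs_probe_le[OF K, of l x w]] N'b[of w] by (auto simp: abs_mult)
  qed simp
  have "expectation (\<lambda>w. real (N_total R l (\<lambda>y. f y w)) * probe l K x w)
    = expectation (\<lambda>w. N' w * probe l K x w + ?pL * indicator (good l K x \<inter> {w \<in> space M. innov x w \<in> {K<..}}) w)"
    by (intro Bochner_Integration.integral_cong refl pointwise)
  also have "\<dots> = expectation (\<lambda>w. N' w * probe l K x w) + ?pL * prob (good l K x \<inter> {w \<in> space M. innov x w \<in> {K<..}})"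
    by (subst Bochner_Integration.integral_add[OF i]) (auto simp: less_top[symmetric])
  also have "expectation (\<lambda>w. N' w * probe l K x w) = 0"
    by (rule expectation_mult_probe[OF K N'm N'b])
  also have "prob (good l K x \<inter> {w \<in> space M. innov x w \<in> {K<..}}) = prob (good l K x) * ?pU"
    by (rule prob_inter_innov) (auto intro: good_off)
  finally show ?thesis by simp
qed

lemma variance_N_total_lower_bound:
  "\<exists>c>0. \<forall>R\<ge>1. c * R ^ CARD('d) \<le> variance (\<lambda>w. real (N_total R l (\<lambda>y. f y w)))"
proof -
  obtain c K where c: "c > 0" and K: "K \<ge> 0" and good: "\<And>x. c \<le> prob (good l K x)"
    using prob_good_lower_bound by blast
  let ?p = "measure std_normal_distribution {..<- K} * measure std_normal_distribution {K<..}"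
  have p: "?p > 0" by (intro mult_pos_pos std_normal_Iio_pos std_normal_Ioi_pos)
  \<comment> \<open>A correlation that every probe attains. The variance constant also carries a
    factor 3^(-d), from the number of sites.\<close>
  define a where "a = ?p * c"
  have a: "a > 0" using p c by (simp add: a_def)
  have "a\<^sup>2 / 3 ^ CARD('d) * R ^ CARD('d) \<le> variance (\<lambda>w. real (N_total R l (\<lambda>y. f y w)))"
    if R: "R \<ge> 1" for R
  proof -
    have "a\<^sup>2 / 3 ^ CARD('d) * R ^ CARD('d) = a\<^sup>2 * (R / 3) ^ CARD('d)" by (simp add: power_divide)
    also have "\<dots> \<le> a\<^sup>2 * card (sites R :: (int ^ 'd) set)" using card_sites[OF R, where 'd = 'd] by (intro mult_left_mono) auto
    also have "\<dots> \<le> variance (\<lambda>w. real (N_total R l (\<lambda>y. f y w)))"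
    proof (rule variance_ge_orthogonal[where Y = "probe l K"])
      show "(\<lambda>w. real (N_total R l (\<lambda>y. f y w))) \<in> borel_measurable M"
        by (rule borel_measurable_N_total) measurable
      show "\<bar>real (N_total R l (\<lambda>y. f y w))\<bar> \<le> real (2 * card (Pow (lattice_box R :: (int ^ 'd) set)))" for w
        using N_total_le[of R l "\<lambda>y. f y w"] by (simp del: of_nat_mult)
      fix x :: "int ^ 'd" assume x: "x \<in> sites R"
      show "a \<le> expectation (\<lambda>w. real (N_total R l (\<lambda>y. f y w)) * probe l K x w)"
        unfolding count_probe_correlation[OF K sites_interior[OF x]] a_def
        using p good by (intro mult_left_mono) auto
    qed (use K a in \<open>auto simp: abs_probe_le expectation_probe intro!: probe_orthogonal dest: sites_separated\<close>)
    finally show ?thesis .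
  qed
  then show ?thesis using a by (intro exI[of _ "a\<^sup>2 / 3 ^ CARD('d)"]) auto
qed

end

theorem proposition5p1:
  fixes M :: "'w measure" and f :: "int ^ 'd \<Rightarrow> 'w \<Rightarrow> real"
  assumes "CARD('d) \<ge> 3"
    and "gaussian_free_field M f"
  shows "\<forall>l::real. \<exists>c>0. \<forall>R::real. R \<ge> 1 \<longrightarrow>
    prob_space.variance M (\<lambda>\<omega>. real (N_total R l (\<lambda>x. f x \<omega>))) \<ge> c * R ^ CARD('d)"
proof -
  interpret prob_space M using assms(2) by (simp add: gaussian_free_field_def)
  interpret lattice_gff M f
    by unfold_locales (use assms in \<open>auto simp: gaussian_free_field_def\<close>)
  show ?thesis using variance_N_total_lower_bound by blast
qed

end
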